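(* Every countable Borel equivalence relation $(X, E)$ Borel embeds into a countable Borel equivalence relation $(Y, F)$ structurable by locally finite contractible simplicial complexes.
   Context: A countable Borel equivalence relation $(X,E)$ is a Borel equivalence relation $E \subseteq X^2$ on a standard Borel space $X$ all of whose classes are countable. A Borel embedding from $(X,E)$ to $(Y,F)$ is an injective Borel map $f : X \to Y$ with $x \mathrel{E} x' \iff f(x) \mathrel{F} f(x')$ for all $x,x' \in X$; if one exists, $E$ Borel embeds into $F$. A simplicial complex on a set $X$ is a set $S$ of finite nonempty subsets of $X$ (simplices) containing all singletons and closed under nonempty subsets. An edge is a simplex with exactly two elements; $S$ is locally finite if each vertex is contained in finitely many edges. The geometric realization $|S|$ is $\bigcup_{s\in S}|s|_S \subseteq [0,1]^X$, where $|s|_S$ is the set of $(a_x)_{x \in X}$ with $\sum_x a_x = 1$ and $a_x = 0$ for $x \notin s$, with the topology in which a set is open iff its intersection with each $|s|_S$ is open in the Euclidean topology of $|s|_S$. $S$ is contractible if $|S|$ is. For a class $\mathcal{K}$ of simplicial complexes, a (Borel) structuring of $(X,E)$ by complexes in $\mathcal{K}$ is a simplicial complex $S$ on $X$ which is Borel as a subset of the standard Borel space of finite subsets of $X$, such that each simplex of $S$ is contained in a single $E$-class, and such that for each $E$-class $C$ the complex $S_C := \{s \in S \mid s \subseteq C\}$ on $C$ belongs to $\mathcal{K}$. $E$ is structurable by complexes in $\mathcal{K}$ if such a structuring exists. *)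

theory Defs
  imports "HOL-Analysis.Analysis"
begin

section \<open>Countable Borel equivalence relations\<close>

text \<open>
  Of a value of type \<open>'a measure\<close> only the underlying measurable space
  (\<open>space\<close> and \<open>sets\<close>) is used; the measure itself plays no role.
\<close>

definition standard_borel :: "'a measure \<Rightarrow> bool" where
  "standard_borel M \<longleftrightarrow>
     (\<exists>T. completely_metrizable_space T \<and> separable_space T \<and> topspace T = space M \<and>
          sets M = sigma_sets (space M) {U. openin T U})"

definition countable_borel_equiv :: "'a measure \<Rightarrow> ('a \<times> 'a) set \<Rightarrow> bool" where
  "countable_borel_equiv M E \<longleftrightarrow>
     standard_borel M \<and> equiv (space M) E \<and> E \<in> sets (M \<Otimes>\<^sub>M M) \<and>
     (\<forall>C\<in>space M // E. countable C)"

definition borel_embedding ::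
    "'a measure \<Rightarrow> ('a \<times> 'a) set \<Rightarrow> 'b measure \<Rightarrow> ('b \<times> 'b) set \<Rightarrow> ('a \<Rightarrow> 'b) \<Rightarrow> bool" where
  "borel_embedding M E N F f \<longleftrightarrow>
     f \<in> measurable M N \<and> inj_on f (space M) \<and>
     (\<forall>x\<in>space M. \<forall>y\<in>space M. (x, y) \<in> E \<longleftrightarrow> (f x, f y) \<in> F)"

definition borel_embeds ::
    "'a measure \<Rightarrow> ('a \<times> 'a) set \<Rightarrow> 'b measure \<Rightarrow> ('b \<times> 'b) set \<Rightarrow> bool" where
  "borel_embeds M E N F \<longleftrightarrow> (\<exists>f. borel_embedding M E N F f)"


section \<open>Abstract simplicial complexes\<close>

definition simplicial_complex_on :: "'a set \<Rightarrow> 'a set set \<Rightarrow> bool" where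
  "simplicial_complex_on A S \<longleftrightarrow>
     (\<forall>s\<in>S. finite s \<and> s \<noteq> {} \<and> s \<subseteq> A) \<and>
     (\<forall>x\<in>A. {x} \<in> S) \<and>
     (\<forall>s\<in>S. \<forall>t. t \<noteq> {} \<and> t \<subseteq> s \<longrightarrow> t \<in> S)"

definition edges :: "'a set set \<Rightarrow> 'a set set" where
  "edges S = {s \<in> S. card s = 2}"

definition locally_finite_complex :: "'a set \<Rightarrow> 'a set set \<Rightarrow> bool" where
  "locally_finite_complex A S \<longleftrightarrow> (\<forall>x\<in>A. finite {e \<in> edges S. x \<in> e})"

text \<open>
  Points of the realization are families \<open>a\<close> indexed by the whole type; for a
  complex on a vertex set \<open>A\<close> they vanish outside \<open>A\<close>, so they correspond to points of
  $[0,1]^A$.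
\<close>

definition simplex_realization :: "'a set \<Rightarrow> ('a \<Rightarrow> real) set" where
  "simplex_realization s = {a. (\<forall>x. a x \<in> {0..1}) \<and> (\<forall>x. x \<notin> s \<longrightarrow> a x = 0) \<and> (\<Sum>x\<in>s. a x) = 1}"

text \<open>
  The type \<open>'a \<Rightarrow> real\<close> carries the product topology; on the realization of a
  finite simplex \<open>s\<close>, where only finitely many coordinates are nonzero, it induces the
  Euclidean topology. The realization itself has the weak topology, not the subspace topology.
\<close>

definition realization :: "'a set set \<Rightarrow> ('a \<Rightarrow> real) topology" where
  "realization S =
     topology (\<lambda>U. U \<subseteq> (\<Union>s\<in>S. simplex_realization s) \<and>
       (\<forall>s\<in>S. openin (top_of_set (simplex_realization s)) (U \<inter> simplex_realization s)))"

lemma openin_realization: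
  "openin (realization S) U \<longleftrightarrow>
     U \<subseteq> (\<Union>s\<in>S. simplex_realization s) \<and>
     (\<forall>s\<in>S. openin (top_of_set (simplex_realization s)) (U \<inter> simplex_realization s))"
proof -
  define R :: "('a \<Rightarrow> real) set" where "R = (\<Union>s\<in>S. simplex_realization s)"
  define P where "P = (\<lambda>U. U \<subseteq> R \<and>
     (\<forall>s\<in>S. openin (top_of_set (simplex_realization s)) (U \<inter> simplex_realization s)))"
  have Int: "P (U \<inter> V)" if "P U" "P V" for U V
  proof -
    have "openin (top_of_set (simplex_realization s)) (U \<inter> V \<inter> simplex_realization s)"
      if "s \<in> S" for s
    proof -
      have "openin (top_of_set (simplex_realization s))
          ((U \<inter> simplex_realization s) \<inter> (V \<inter> simplex_realization s))"
        by (rule openin_Int) (use \<open>P U\<close> \<open>P V\<close> \<open>s \<in> S\<close> in \<open>simp_all only: P_def\<close>)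
      moreover have "(U \<inter> simplex_realization s) \<inter> (V \<inter> simplex_realization s) =
          U \<inter> V \<inter> simplex_realization s"
        by blast
      ultimately show ?thesis by (simp only:)
    qed
    moreover have "U \<inter> V \<subseteq> R" using \<open>P U\<close> unfolding P_def by blast
    ultimately show ?thesis unfolding P_def by blast
  qed
  have Un: "P (\<Union>K)" if K: "\<forall>U\<in>K. P U" for K
  proof -
    have "openin (top_of_set (simplex_realization s)) (\<Union>K \<inter> simplex_realization s)"
      if "s \<in> S" for s
    proof -
      have "openin (top_of_set (simplex_realization s))
          (\<Union>((\<lambda>U. U \<inter> simplex_realization s) ` K))"
      proof (rule openin_Union)
        fix V assume "V \<in> (\<lambda>U. U \<inter> simplex_realization s) ` K"
        then obtain U where "U \<in> K" "V = U \<inter> simplex_realization s" by (rule imageE)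
        then show "openin (top_of_set (simplex_realization s)) V"
          using K \<open>s \<in> S\<close> by (simp only: P_def)
      qed
      moreover have "\<Union>((\<lambda>U. U \<inter> simplex_realization s) ` K) = \<Union>K \<inter> simplex_realization s"
        by blast
      ultimately show ?thesis by (simp only:)
    qed
    moreover have "\<Union>K \<subseteq> R" using K unfolding P_def by blast
    ultimately show ?thesis unfolding P_def by blast
  qed
  have "istopology P"
    using Int Un unfolding istopology_def by blast
  moreover have "realization S = topology P"
    unfolding realization_def P_def R_def ..
  ultimately have "openin (realization S) = P"
    by (simp only: topology_inverse')
  then show ?thesis by (simp only: P_def R_def)
qed

lemma topspace_realization: "topspace (realization S) = (\<Union>s\<in>S. simplex_realization s)"
proof
  show "topspace (realization S) \<subseteq> (\<Union>s\<in>S. simplex_realization s)"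
    using openin_topspace[of "realization S"] unfolding openin_realization by (rule conjunct1)
  have "openin (top_of_set (simplex_realization s))
      ((\<Union>s\<in>S. simplex_realization s) \<inter> simplex_realization s)" if "s \<in> S" for s
  proof -
    have "(\<Union>s\<in>S. simplex_realization s) \<inter> simplex_realization s = simplex_realization s"
      using that by blast
    then show ?thesis by (simp only: openin_subtopology_self)
  qed
  then have "openin (realization S) (\<Union>s\<in>S. simplex_realization s)"
    unfolding openin_realization by blast
  then show "(\<Union>s\<in>S. simplex_realization s) \<subseteq> topspace (realization S)"
    by (rule openin_subset)
qed

definition contractible_complex :: "'a set set \<Rightarrow> bool" where
  "contractible_complex S \<longleftrightarrow> contractible_space (realization S)"


section \<open>Borel structurings\<close>

text \<open>
  The standard Borel space of finite subsets of \<open>M\<close>: the quotient of the space of finite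
  sequences in \<open>M\<close> by the map sending a sequence to its range. A set \<open>B\<close> of finite subsets is
  Borel iff for each \<open>n\<close> the set of sequences of length \<open>n\<close> with range in \<open>B\<close> is
  Borel in the \<open>n\<close>-th power of \<open>M\<close>.
\<close>

definition borel_finite_sets :: "'a measure \<Rightarrow> 'a set set set" where
  "borel_finite_sets M =
     {B. B \<subseteq> {s. finite s \<and> s \<subseteq> space M} \<and>
         (\<forall>n. {x \<in> space (PiM {..<n::nat} (\<lambda>_. M)). x ` {..<n} \<in> B} \<in> sets (PiM {..<n} (\<lambda>_. M)))}"

definition finite_subsets_space :: "'a measure \<Rightarrow> 'a set measure" where
  "finite_subsets_space M = sigma {s. finite s \<and> s \<subseteq> space M} (borel_finite_sets M)"

lemma space_finite_subsets_space:
  "space (finite_subsets_space M) = {s. finite s \<and> s \<subseteq> space M}"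
  unfolding finite_subsets_space_def
  by (rule space_measure_of) (auto simp: borel_finite_sets_def)

lemma sets_finite_subsets_space: "sets (finite_subsets_space M) = borel_finite_sets M"
proof -
  let ?\<Omega> = "{s. finite s \<and> s \<subseteq> space M}"
  let ?P = "\<lambda>n::nat. PiM {..<n} (\<lambda>_. M)"
  have range: "x ` {..<n} \<in> ?\<Omega>" if "x \<in> space (?P n)" for n x
    using that by (auto simp: space_PiM)
  have "sigma_algebra ?\<Omega> (borel_finite_sets M)"
    unfolding sigma_algebra_iff2
  proof (intro conjI ballI allI impI)
    show "borel_finite_sets M \<subseteq> Pow ?\<Omega>" "{} \<in> borel_finite_sets M"
      by (auto simp: borel_finite_sets_def)
  next
    fix B assume B: "B \<in> borel_finite_sets M"
    have "{x \<in> space (?P n). x ` {..<n} \<in> ?\<Omega> - B} \<in> sets (?P n)" for n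
    proof -
      have "{x \<in> space (?P n). x ` {..<n} \<in> ?\<Omega> - B} =
          space (?P n) - {x \<in> space (?P n). x ` {..<n} \<in> B}"
        using range by auto
      then show ?thesis
        using B by (auto simp only: borel_finite_sets_def intro!: sets.compl_sets)
    qed
    then show "?\<Omega> - B \<in> borel_finite_sets M"
      unfolding borel_finite_sets_def by blast
  next
    fix A :: "nat \<Rightarrow> 'a set set" assume A: "range A \<subseteq> borel_finite_sets M"
    have "{x \<in> space (?P n). x ` {..<n} \<in> (\<Union>i. A i)} \<in> sets (?P n)" for n
    proof -
      have "{x \<in> space (?P n). x ` {..<n} \<in> (\<Union>i. A i)} =
          (\<Union>i. {x \<in> space (?P n). x ` {..<n} \<in> A i})"
        by auto
      moreover have "{x \<in> space (?P n). x ` {..<n} \<in> A i} \<in> sets (?P n)" for i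
        using A unfolding borel_finite_sets_def by blast
      ultimately show ?thesis by auto
    qed
    moreover have "(\<Union>i. A i) \<subseteq> ?\<Omega>"
      using A unfolding borel_finite_sets_def by blast
    ultimately show "(\<Union>i. A i) \<in> borel_finite_sets M"
      unfolding borel_finite_sets_def by blast
  qed
  then show ?thesis
    unfolding finite_subsets_space_def by (rule sigma_algebra.sets_measure_of_eq)
qed

text \<open>
  A class of complexes is a predicate \<open>K\<close> taking a vertex set and the set of simplices.
\<close>

definition borel_structuring ::
    "('a set \<Rightarrow> 'a set set \<Rightarrow> bool) \<Rightarrow> 'a measure \<Rightarrow> ('a \<times> 'a) set \<Rightarrow> 'a set set \<Rightarrow> bool" where
  "borel_structuring K M E S \<longleftrightarrow>
     simplicial_complex_on (space M) S \<and>
     S \<in> sets (finite_subsets_space M) \<and>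
     (\<forall>s\<in>S. \<exists>C\<in>space M // E. s \<subseteq> C) \<and>
     (\<forall>C\<in>space M // E. K C {s \<in> S. s \<subseteq> C})"

definition structurable ::
    "('a set \<Rightarrow> 'a set set \<Rightarrow> bool) \<Rightarrow> 'a measure \<Rightarrow> ('a \<times> 'a) set \<Rightarrow> bool" where
  "structurable K M E \<longleftrightarrow> (\<exists>S. borel_structuring K M E S)"

definition locally_finite_contractible :: "'a set \<Rightarrow> 'a set set \<Rightarrow> bool" where
  "locally_finite_contractible A S \<longleftrightarrow>
     simplicial_complex_on A S \<and> locally_finite_complex A S \<and> contractible_complex S"

text \<open>
  HOL cannot quantify existentially over types, so an existentially quantified standard Borel
  space is given the carrier type \<open>real\<close>. This is no restriction: its points form an
  arbitrary set of reals and its Borel structure need not be the usual one, and every standard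
  Borel space has at most continuum many points, hence is isomorphic to one of this form by
  transport along an injection.
\<close>

end

theory Submission
  imports Defs
begin

text \<open>
  By the Lusin--Novikov theorem \<open>E\<close> is an increasing union of Borel symmetric reflexive graphs \<open>G k\<close>
  with finite vertex degrees. Their clique complexes increase to the complex of all finite
  subsets of \<open>E\<close>-classes, which is contractible on each class but not locally finite. As in
  Whitehead's theorem on countable CW complexes, the mapping telescope of the sequence, a complex on
  \<open>X \<times> \<nat>\<close>, is locally finite and still contractible: a point \<open>a\<close> is pushed up to a level \<open>m a\<close>, depending
  continuously on \<open>a\<close>, at which its support is joined to a base point, then moved
  straight to the base point, and finally brought down along the vertical ray of the base point.
\<close>

section \<open>Lusin separation\<close>

text \<open>In general there is no Borel choice of a base point in every class, so the contraction
  cannot be made uniformly in a Borel way. Only the complex itself has to be Borel, and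
  \<open>telescope\<close> is built from \<open>G\<close> without choices; contractibility is proved
  for one class at a time, with an arbitrary base point.

  The levels are what buys finiteness: a simplex between levels \<open>k\<close> and
  \<open>k + 1\<close> uses only edges of \<open>G k\<close>, so each vertex has finitely many
  neighbours, while any two equivalent points are still joined at high levels. \<open>E\<close> sits
  inside as level 0.

  Local finiteness also pays for the homotopies: the weak topology becomes the product topology,
  where continuity is checked coordinate by coordinate, and a sum over a support becomes locally a
  sum over a fixed finite set.

  The Borel graphs behind \<open>G\<close> are found through analytic sets. Lusin separation, for
  any finite number of sets at once, is the step that turns analytic sets into Borel ones.\<close>

lemma countable_closed_nbhds:
  obtains K :: "nat \<Rightarrow> 'p::{metric_space, second_countable_topology} set"
  where "\<And>n. closed (K n)" "\<And>U w. open U \<Longrightarrow> w \<in> U \<Longrightarrow> \<exists>n. w \<in> K n \<and> K n \<subseteq> U"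
proof -
  obtain B :: "'p set set" where B: "countable B" "topological_basis B"
    using ex_countable_basis by blast
  have ne: "B \<noteq> {}"
  proof
    assume "B = {}"
    moreover obtain A where "A \<in> B" "(undefined::'p) \<in> A"
      using topological_basisE[OF B(2) open_UNIV UNIV_I] by metis
    ultimately show False by simp
  qed
  define K where "K n = closure (from_nat_into B n)" for n
  show thesis
  proof
    show "closed (K n)" for n by (simp add: K_def)
    fix U and w :: 'p assume "open U" "w \<in> U"
    then obtain e where e: "e > 0" "cball w e \<subseteq> U" by (meson open_contains_cball)
    have "w \<in> ball w e" using e(1) by simp
    then obtain A where A: "A \<in> B" "w \<in> A" "A \<subseteq> ball w e"
      by (rule topological_basisE[OF B(2) open_ball])
    have "closure A \<subseteq> cball w e"
      using A(3) ball_subset_cball[of w e] by (intro closure_minimal) auto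
    moreover obtain n where "from_nat_into B n = A"
      using from_nat_into_surj[OF B(1) A(1)] by blast
    ultimately have "w \<in> K n \<and> K n \<subseteq> U"
      unfolding K_def using A(2) e(2) closure_subset[of A] by blast
    then show "\<exists>n. w \<in> K n \<and> K n \<subseteq> U" ..
  qed
qed

lemma small_closed_cover:
  fixes e :: real
  assumes "e > 0"
  obtains K :: "nat \<Rightarrow> 'p::{metric_space, second_countable_topology} set"
  where "\<And>n. closed (K n)" "\<And>n x y. x \<in> K n \<Longrightarrow> y \<in> K n \<Longrightarrow> dist x y < e" "(\<Union>n. K n) = UNIV"
proof -
  obtain K :: "nat \<Rightarrow> 'p set" where K: "\<And>n. closed (K n)"
    "\<And>U w. open U \<Longrightarrow> w \<in> U \<Longrightarrow> \<exists>n. w \<in> K n \<and> K n \<subseteq> U"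
    using countable_closed_nbhds by blast
  \<comment> \<open>Pieces of the countable family that are too large become empty, which keeps the
    indexing by \<open>nat\<close>.\<close>
  define L where "L n = (if \<forall>x\<in>K n. \<forall>y\<in>K n. dist x y < e then K n else {})" for n
  show thesis
  proof
    show "closed (L n)" for n using K(1) by (simp add: L_def)
    show "dist x y < e" if "x \<in> L n" "y \<in> L n" for n x y
      using that by (auto simp: L_def split: if_splits)
    have "\<exists>n. w \<in> L n" for w
    proof -
      obtain n where n: "w \<in> K n" "K n \<subseteq> ball w (e/2)"
        using K(2)[of "ball w (e/2)" w] assms by auto
      have "dist x y < e" if "x \<in> K n" "y \<in> K n" for x y
        using n(2) that dist_triangle_half_r[of w x e y] by (auto simp: subset_iff)
      then have "w \<in> L n" using n(1) by (simp add: L_def)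
      then show ?thesis ..
    qed
    then show "(\<Union>n. L n) = UNIV" by blast
  qed
qed

text \<open>Projections of closed sets are stable under countable unions and intersections, but in
  general not under complements; the induction therefore carries a set and its complement together.
  \<open>nat \<Rightarrow> real\<close> serves as parameter space because one sequence can store a
  natural number with a sequence, or countably many sequences.\<close>

lemma borel_eq_fst_image_closed:
  fixes B :: "'p::{metric_space, second_countable_topology} set"
  assumes "B \<in> sets borel"
  shows "\<exists>F :: ('p \<times> (nat \<Rightarrow> real)) set. closed F \<and> B = fst ` F"
proof -
  define an where "an B \<longleftrightarrow> (\<exists>F :: ('p \<times> (nat \<Rightarrow> real)) set. closed F \<and> B = fst ` F)" for B
  have an_closed: "an C" if "closed C" for C
  proof -
    have "C = fst ` (C \<times> (UNIV :: (nat \<Rightarrow> real) set))" by auto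
    moreover have "closed (C \<times> (UNIV :: (nat \<Rightarrow> real) set))" using that by (intro closed_Times) auto
    ultimately show ?thesis unfolding an_def by blast
  qed
  have c: "continuous_on UNIV (\<lambda>p::'p \<times> (nat \<Rightarrow> real). (fst p, \<lambda>k. snd p (h k)))" for h
    by (intro continuous_on_Pair continuous_on_fst continuous_on_id
        continuous_on_coordinatewise_then_product)
      (rule continuous_on_product_then_coordinatewise[OF continuous_on_snd[OF continuous_on_id]])
  have an_UN: "an (\<Union>n. A n)" if "\<And>n. an (A n)" for A :: "nat \<Rightarrow> 'p set"
  proof -
    obtain F :: "nat \<Rightarrow> ('p \<times> (nat \<Rightarrow> real)) set" where F: "\<And>n. closed (F n)" "\<And>n. A n = fst ` F n"
      using \<open>\<And>n. an (A n)\<close> unfolding an_def by metis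
    \<comment> \<open>Coordinate 0 records which \<open>F n\<close> is meant; the shifted sequence
      is the parameter for it.\<close>
    define G where "G = {p. \<exists>n. snd p 0 = real n \<and> (fst p, \<lambda>k. snd p (Suc k)) \<in> F n}"
    have c0: "continuous_on UNIV (\<lambda>p::'p \<times> (nat \<Rightarrow> real). snd p 0)"
      by (rule continuous_on_product_then_coordinatewise[OF continuous_on_snd[OF continuous_on_id]])
    have sep: "m = n" if "dist (real m) (real n) < 1" for m n
      using that by (simp add: dist_real_def)
    \<comment> \<open>Near a natural number \<open>n\<close> only \<open>F n\<close> matters: the
      unit ball around \<open>n\<close> contains no other natural number.\<close>
    have "- G = (\<lambda>p. snd p 0) -` (- \<nat>) \<union>
        (\<Union>n. (\<lambda>p. snd p 0) -` ball (real n) 1 \<inter> (\<lambda>p. (fst p, \<lambda>k. snd p (Suc k))) -` (- F n))"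
      unfolding G_def by (auto simp: Nats_def dest: sep)
    moreover have "open \<dots>"
      using F(1) c c0 by (intro open_UN ballI open_Int open_Un open_vimage) auto
    ultimately have "closed G" by (simp add: closed_def)
    moreover have "(\<Union>n. A n) = fst ` G"
    proof safe
      fix x n assume "x \<in> A n"
      then obtain a where "(x, a) \<in> F n" using F(2) by force
      then have "(x, case_nat (real n) a) \<in> G" by (auto simp: G_def)
      then show "x \<in> fst ` G" by force
    next
      fix x a assume "(x, a) \<in> G"
      then show "fst (x, a) \<in> (\<Union>n. A n)" using F(2) by (force simp: G_def)
    qed
    ultimately show ?thesis unfolding an_def by blast
  qed
  have an_INT: "an (\<Inter>n. A n)" if "\<And>n. an (A n)" for A :: "nat \<Rightarrow> 'p set"
  proof -
    obtain F :: "nat \<Rightarrow> ('p \<times> (nat \<Rightarrow> real)) set" where F: "\<And>n. closed (F n)" "\<And>n. A n = fst ` F n"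
      using \<open>\<And>n. an (A n)\<close> unfolding an_def by metis
    \<comment> \<open>\<open>prod_encode\<close> splits one parameter into countably many, one for
      each \<open>F n\<close>, over the same point.\<close>
    define G where "G = (\<Inter>n. (\<lambda>p. (fst p, \<lambda>k. snd p (prod_encode (n, k)))) -` F n)"
    have "closed G" unfolding G_def
      using F(1) c by (intro closed_INT ballI closed_vimage)
    moreover have "(\<Inter>n. A n) = fst ` G"
    proof safe
      fix x assume "x \<in> (\<Inter>n. A n)"
      then have "\<forall>n. \<exists>a. (x, a) \<in> F n" using F(2) by force
      then obtain a where a: "\<And>n. (x, a n) \<in> F n" by metis
      have "(x, \<lambda>j. a (fst (prod_decode j)) (snd (prod_decode j))) \<in> G" by (simp add: G_def a)
      then show "x \<in> fst ` G" by force
    next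
      fix x a n assume "(x, a) \<in> G"
      then show "fst (x, a) \<in> A n" using F(2) by (force simp: G_def)
    qed
    ultimately show ?thesis unfolding an_def by blast
  qed
  have an_open: "an U" if U: "open U" for U
  proof -
    obtain K :: "nat \<Rightarrow> 'p set" where K: "\<And>n. closed (K n)"
      "\<And>U w. open U \<Longrightarrow> w \<in> U \<Longrightarrow> \<exists>n. w \<in> K n \<and> K n \<subseteq> U"
      using countable_closed_nbhds by blast
    have "U = (\<Union>n. if K n \<subseteq> U then K n else {})"
      using K(2)[OF U] by (fastforce split: if_splits)
    moreover have "an (\<Union>n. if K n \<subseteq> U then K n else {})"
      by (intro an_UN an_closed) (simp add: K(1))
    ultimately show ?thesis by simp
  qed
  have "B \<in> sigma_sets UNIV (Collect closed)"
    using assms by (simp add: borel_eq_closed)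
  then have "an B \<and> an (- B)"
  proof induction
    case (Basic a)
    then show ?case using an_closed an_open[of "- a"] by (auto simp: open_closed)
  next
    case Empty
    then show ?case using an_closed by auto
  next
    case (Compl a)
    then show ?case by (simp add: Compl_eq_Diff_UNIV[symmetric])
  next
    case (Union a)
    then show ?case by (simp add: an_UN an_INT)
  qed
  then show ?thesis by (simp add: an_def)
qed

text \<open>Inseparability passes from a tuple of sets to some tuple of small closed pieces, hence
  down to a tuple of points \<open>w i\<close>. Their images cannot all agree, and two different
  images have disjoint neighbourhoods, which separate a late stage of the descent. Tuples of
  arbitrary length serve \<open>small_family_split\<close>, which separates one set for each
  coordinate.\<close>

lemma lusin_separation_closed:
  fixes f :: "'p::{complete_space, second_countable_topology} \<Rightarrow> 'z::t2_space"
    and C :: "nat \<Rightarrow> 'p set" and m :: nat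
  assumes C: "\<And>i. closed (C i)" and f: "continuous_on UNIV f"
    and disj: "(\<Inter>i<m. f ` C i) = {}"
  shows "\<exists>B. (\<forall>i<m. B i \<in> sets borel \<and> f ` C i \<subseteq> B i) \<and> (\<Inter>i<m. B i) = {}"
proof (rule ccontr)
  define sep where
    "sep C \<longleftrightarrow> (\<exists>B. (\<forall>i<m. B i \<in> sets borel \<and> f ` C i \<subseteq> B i) \<and> (\<Inter>i<m. B i) = {})" 
    for C :: "nat \<Rightarrow> 'p set"
  have sep_add: "sep C" if cov: "(\<Union>n. K n) = UNIV" and sep: "\<And>J. sep (\<lambda>i. C i \<inter> K (J i))"
    for C and K :: "nat \<Rightarrow> 'p set"
  proof -
    \<comment> \<open>Only the values of \<open>J\<close> below \<open>m\<close> matter; restricting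
      to them leaves countably many index functions.\<close>
    define I where "I = PiE {..<m} (\<lambda>_. UNIV :: nat set)"
    have cI: "countable I" unfolding I_def by (intro countable_PiE) auto
    obtain B where B: "\<And>J i. i < m \<Longrightarrow> B J i \<in> sets borel" 
        "\<And>J i. i < m \<Longrightarrow> f ` (C i \<inter> K (J i)) \<subseteq> B J i" "\<And>J. (\<Inter>i<m. B J i) = {}"
      using sep unfolding sep_def by metis
    \<comment> \<open>a point in all \<open>D i\<close> selects one \<open>n\<close> for each \<open>i\<close>, that is, a single \<open>J\<close>\<close>
    define D where "D i = (\<Union>n. \<Inter>J\<in>{J\<in>I. J i = n}. B J i)" for i
    have "D i \<in> sets borel" if "i < m" for i
    proof -
      have "countable {J \<in> I. J i = n}" for n
        using cI by (rule countable_subset[rotated]) auto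
      then have "(\<Inter>J\<in>{J\<in>I. J i = n}. B J i) \<in> sets borel" for n
        using B(1)[OF that] by (intro sets.countable_INT'') auto
      then show ?thesis unfolding D_def by auto
    qed
    moreover have "f ` C i \<subseteq> D i" if "i < m" for i
    proof
      fix z assume "z \<in> f ` C i"
      then obtain w where w: "w \<in> C i" "z = f w" by blast
      obtain n where "w \<in> K n" using cov by blast
      then have "z \<in> B J i" if "J i = n" for J
        using B(2)[OF \<open>i < m\<close>, of J] w that by blast
      then show "z \<in> D i" unfolding D_def by blast
    qed
    moreover have "z \<notin> (\<Inter>i<m. D i)" for z
    proof
      assume z: "z \<in> (\<Inter>i<m. D i)"
      have "\<exists>n. \<forall>J\<in>I. J i = n \<longrightarrow> z \<in> B J i" if "i < m" for i
      proof -
        have "z \<in> D i" using z that by blast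
        then show ?thesis by (simp add: D_def) blast
      qed
      then obtain N where N: "\<And>i J. i < m \<Longrightarrow> J \<in> I \<Longrightarrow> J i = N i \<Longrightarrow> z \<in> B J i" by metis
      have "z \<in> (\<Inter>i<m. B (restrict N {..<m}) i)"
        by (auto intro!: N simp: I_def)
      then show False using B(3) by blast
    qed
    ultimately show ?thesis unfolding sep_def by blast
  qed
  assume "\<not> ?thesis"
  then have nsep: "\<not> sep C" by (simp add: sep_def)
  have "\<exists>S. \<forall>n. (\<not> sep (S n) \<and> (\<forall>i. closed (S n i))) \<and> (n = 0 \<longrightarrow> S n = C) \<and>
     (\<forall>i. S (Suc n) i \<subseteq> S n i \<and> (\<forall>x\<in>S (Suc n) i. \<forall>y\<in>S (Suc n) i. dist x y < inverse (Suc n)))"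
  proof -
    have "\<exists>S. \<forall>n. ((\<not> sep (S n) \<and> (\<forall>i. closed (S n i))) \<and> (n = 0 \<longrightarrow> S n = C)) \<and>
     (\<forall>i. S (Suc n) i \<subseteq> S n i \<and> (\<forall>x\<in>S (Suc n) i. \<forall>y\<in>S (Suc n) i. dist x y < inverse (Suc n)))"
    proof (rule dependent_nat_choice, goal_cases)
      case 1
      then show ?case using nsep C by auto
    next
      case (2 T n)
      have pos: "0 < inverse (real (Suc n))" by simp
      obtain K :: "nat \<Rightarrow> 'p set" where K: "\<And>n. closed (K n)" 
        "\<And>k x y. x \<in> K k \<Longrightarrow> y \<in> K k \<Longrightarrow> dist x y < inverse (Suc n)" "(\<Union>n. K n) = UNIV"
        by (rule small_closed_cover[OF pos]) blast
      obtain J where J: "\<not> sep (\<lambda>i. T i \<inter> K (J i))" using 2 sep_add[OF K(3)] by blast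
      then show ?case using 2 K(1,2)
        by (intro exI[of _ "\<lambda>i. T i \<inter> K (J i)"]) auto
    qed
    then show ?thesis by simp
  qed
  then obtain S where S': "\<forall>n. (\<not> sep (S n) \<and> (\<forall>i. closed (S n i))) \<and> (n = 0 \<longrightarrow> S n = C) \<and>
     (\<forall>i. S (Suc n) i \<subseteq> S n i \<and> (\<forall>x\<in>S (Suc n) i. \<forall>y\<in>S (Suc n) i. dist x y < inverse (Suc n)))"
    by (rule exE)
  note S = S'[rule_format, THEN conjunct1, THEN conjunct1]
    S'[rule_format, THEN conjunct1, THEN conjunct2, rule_format]
    S'[rule_format, THEN conjunct2, THEN conjunct1, rule_format, OF refl]
    S'[rule_format, THEN conjunct2, THEN conjunct2, rule_format, THEN conjunct1]
    S'[rule_format, THEN conjunct2, THEN conjunct2, rule_format, THEN conjunct2, rule_format]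
  have S_dec: "S n i \<subseteq> S k i" if "k \<le> n" for n k i
    by (rule lift_Suc_antimono_le[of "\<lambda>n. S n i", OF S(4) that])
  have S_small: "\<exists>n. \<forall>x\<in>S n i. \<forall>y\<in>S n i. dist x y < e" if "e > 0" for e i
  proof -
    obtain n where "inverse (real (Suc n)) < e" using reals_Archimedean \<open>e > 0\<close> by blast
    then have "\<forall>x\<in>S (Suc n) i. \<forall>y\<in>S (Suc n) i. dist x y < e"
      using S(5)[of _ n i] less_trans by blast
    then show ?thesis ..
  qed
  have "\<exists>w. \<forall>n. w \<in> S n i" if "i < m" for i
  proof -
    \<comment> \<open>A tuple with an empty member is separated by the empty set there and the whole
      space elsewhere.\<close>
    have "S n i \<noteq> {}" for n
    proof
      assume "S n i = {}"
      then have "sep (S n)" unfolding sep_def using \<open>i < m\<close>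
        by (intro exI[of _ "\<lambda>j. if j = i then {} else UNIV"]) auto
      then show False using S(1) by blast
    qed
    then obtain w where "\<And>n. w \<in> S n i"
      using decreasing_closed_nest[of "\<lambda>n. S n i"] S(2) S_dec S_small by metis
    then show ?thesis by blast
  qed
  then obtain w where w: "\<And>i n. i < m \<Longrightarrow> w i \<in> S n i" by metis
  have m: "0 < m" using disj by (cases m) auto
  have "\<exists>i<m. f (w i) \<noteq> f (w 0)"
  proof (rule ccontr)
    assume eq: "\<not> ?thesis"
    have "f (w 0) \<in> f ` C i" if "i < m" for i
    proof (rule image_eqI)
      show "w i \<in> C i" using w[OF that, of 0] by (simp only: S(3))
      show "f (w 0) = f (w i)" using eq that by metis
    qed
    then show False using disj by blast
  qed
  then obtain i where i: "i < m" "f (w i) \<noteq> f (w 0)" by blast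
  then have "i \<noteq> 0" by metis
  obtain U V where UV: "open U" "open V" "f (w i) \<in> U" "f (w 0) \<in> V" "U \<inter> V = {}"
    using hausdorff[OF i(2)] by blast
  have ev: "\<exists>n. S n j \<subseteq> f -` W" if "j < m" "open W" "f (w j) \<in> W" for j W
  proof -
    have "open (f -` W)" using f that(2) by (simp add: continuous_on_open_vimage)
    moreover have "w j \<in> f -` W" using that(3) by simp
    ultimately obtain e where e: "e > 0" "ball (w j) e \<subseteq> f -` W"
      using openE by blast
    obtain n where "\<forall>x\<in>S n j. \<forall>y\<in>S n j. dist x y < e" using S_small e(1) by blast
    then have "S n j \<subseteq> ball (w j) e" using w[OF that(1), of n] by (simp add: subset_eq)
    then show ?thesis using e(2) by blast
  qed
  obtain n1 n2 where "S n1 i \<subseteq> f -` U" "S n2 0 \<subseteq> f -` V"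
    using ev[OF i(1) UV(1,3)] ev[OF m UV(2,4)] by blast
  then have "S (max n1 n2) i \<subseteq> f -` U" "S (max n1 n2) 0 \<subseteq> f -` V"
    using S_dec[of n1 "max n1 n2" i] S_dec[of n2 "max n1 n2" 0] by auto
  then have "(\<forall>j<m. B j \<in> sets borel \<and> f ` S (max n1 n2) j \<subseteq> B j) \<and> (\<Inter>j<m. B j) = {}"
    if "B = (\<lambda>j. if j = i then U else if j = 0 then V else UNIV)" for B
    using UV m i(1) \<open>i \<noteq> 0\<close> unfolding that by (auto split: if_splits)
  then have "sep (S (max n1 n2))" unfolding sep_def by blast
  then show False using S(1) by blast
qed

text \<open>Writing each Borel \<open>S i\<close> as a projection of a closed set replaces the
  parameter space by its product with \<open>nat \<Rightarrow> real\<close>, on which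
  \<open>f\<close> is composed with \<open>fst\<close>.\<close>

lemma lusin_separation:
  fixes f :: "'p::{complete_space, second_countable_topology} \<Rightarrow> 'z::t2_space"
    and S :: "nat \<Rightarrow> 'p set" and m :: nat
  assumes S: "\<And>i. i < m \<Longrightarrow> S i \<in> sets borel" and f: "continuous_on UNIV f"
    and disj: "(\<Inter>i<m. f ` S i) = {}"
  obtains B where "\<And>i. i < m \<Longrightarrow> B i \<in> sets borel" "\<And>i. i < m \<Longrightarrow> f ` S i \<subseteq> B i" "(\<Inter>i<m. B i) = {}"
proof -
  have "\<forall>i. \<exists>F :: ('p \<times> (nat \<Rightarrow> real)) set. closed F \<and> (i < m \<longrightarrow> S i = fst ` F)"
    using borel_eq_fst_image_closed[OF S] by (metis closed_empty)
  then obtain F :: "nat \<Rightarrow> ('p \<times> (nat \<Rightarrow> real)) set"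
    where F: "\<And>i. closed (F i)" "\<And>i. i < m \<Longrightarrow> S i = fst ` F i" by metis
  have "continuous_on UNIV (\<lambda>p::'p \<times> (nat \<Rightarrow> real). f (fst p))"
    using f by (intro continuous_on_compose2[OF f] continuous_on_fst continuous_on_id) auto
  moreover have "(\<Inter>i<m. (\<lambda>p. f (fst p)) ` F i) = {}"
    using disj F(2) by (simp add: image_image cong: INF_cong_simp)
  ultimately have "\<exists>B. (\<forall>i<m. B i \<in> sets borel \<and> (\<lambda>p. f (fst p)) ` F i \<subseteq> B i) \<and> (\<Inter>i<m. B i) = {}"
    using F(1) by (intro lusin_separation_closed)
  then obtain B where B: "\<And>i. i < m \<Longrightarrow> B i \<in> sets borel"
    "\<And>i. i < m \<Longrightarrow> (\<lambda>p. f (fst p)) ` F i \<subseteq> B i" "(\<Inter>i<m. B i) = {}" by metis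
  show thesis by (rule that[OF B(1) _ B(3)]) (use B(2) F(2) in \<open>auto simp: image_image\<close>)
qed

section \<open>The Lusin--Novikov theorem\<close>

text \<open>The pairs \<open>(x p, y p)\<close> form an analytic graph of a function. The points
  over which the value lies in \<open>K n\<close> and those over which it does not are disjoint
  analytic sets, so a Borel \<open>D n\<close> separates them. These tests determine the value,
  since the sets \<open>K n\<close> separate points.\<close>

lemma borel_single_valued_cover:
  fixes x :: "'p::{complete_space, second_countable_topology} \<Rightarrow> 'z::t2_space"
    and y :: "'p \<Rightarrow> 'w::{metric_space, second_countable_topology}"
  assumes S: "S \<in> sets borel" and x: "continuous_on UNIV x" and y: "continuous_on UNIV y"
    and sv: "\<And>p q. p \<in> S \<Longrightarrow> q \<in> S \<Longrightarrow> x p = x q \<Longrightarrow> y p = y q"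
  obtains g where "g \<in> sets (borel \<Otimes>\<^sub>M borel)" "single_valued g" "\<And>p. p \<in> S \<Longrightarrow> (x p, y p) \<in> g"
proof -
  obtain K :: "nat \<Rightarrow> 'w set" where K: "\<And>n. closed (K n)"
    "\<And>U w. open U \<Longrightarrow> w \<in> U \<Longrightarrow> \<exists>n. w \<in> K n \<and> K n \<subseteq> U"
    using countable_closed_nbhds by blast
  have "\<exists>D. D \<in> sets borel \<and> (\<forall>p\<in>S. y p \<in> K n \<longleftrightarrow> x p \<in> D)" for n
  proof -
    define T where "T i = (if i = 0 then S \<inter> y -` K n else S \<inter> y -` (- K n))" for i :: nat
    have "T i \<in> sets borel" for i
    proof -
      have "y \<in> borel_measurable borel" using y by (rule borel_measurable_continuous_onI)
      then have "y -` K n \<in> sets borel" "y -` (- K n) \<in> sets borel"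
        using K(1)[of n] by (auto simp: measurable_sets_borel)
      then show ?thesis using S by (auto simp: T_def)
    qed
    moreover have "(\<Inter>i<2. x ` T i) = {}"
    proof -
      have "x p \<noteq> x q" if "p \<in> T 0" "q \<in> T 1" for p q
        using that sv[of p q] by (auto simp: T_def)
      then have "x ` T 0 \<inter> x ` T 1 = {}" by (auto simp del: One_nat_def)
      then show ?thesis by (simp add: numeral_2_eq_2 lessThan_Suc Int_commute)
    qed
    ultimately obtain B where B: "\<And>i. i < 2 \<Longrightarrow> B i \<in> sets borel" "\<And>i. i < 2 \<Longrightarrow> x ` T i \<subseteq> B i"
      "(\<Inter>i<2. B i) = {}"
      by (rule lusin_separation[OF _ x]) blast
    have "B 0 \<inter> B 1 = {}" using B(3) by (simp add: numeral_2_eq_2 lessThan_Suc Int_commute)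
    moreover have "x p \<in> (if y p \<in> K n then B 0 else B 1)" if "p \<in> S" for p
      using that B(2)[of 0] B(2)[of 1] by (auto simp: T_def)
    ultimately have "\<forall>p\<in>S. y p \<in> K n \<longleftrightarrow> x p \<in> B 0"
      by (metis IntI empty_iff)
    then show ?thesis using B(1)[of 0] by auto
  qed
  then obtain D where D: "\<And>n. D n \<in> sets borel" "\<And>n p. p \<in> S \<Longrightarrow> y p \<in> K n \<longleftrightarrow> x p \<in> D n" by metis
  \<comment> \<open>Pairs whose first entry predicts correctly, through every \<open>D n\<close>,
    whether the second lies in \<open>K n\<close>.\<close>
  define g where "g = (\<Inter>n. D n \<times> K n \<union> (- D n) \<times> (- K n))"
  show thesis
  proof
    have "D n \<times> K n \<union> (- D n) \<times> (- K n) \<in> sets (borel \<Otimes>\<^sub>M borel)" for n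
      using D(1)[of n] K(1)[of n] by (intro sets.Un pair_measureI) auto
    then show "g \<in> sets (borel \<Otimes>\<^sub>M borel)" unfolding g_def by auto
    show "single_valued g"
    proof (rule single_valuedI)
      fix a b c assume "(a, b) \<in> g" "(a, c) \<in> g"
      then have "b \<in> K n \<longleftrightarrow> c \<in> K n" for n unfolding g_def by blast
      moreover have "\<exists>n. b \<in> K n \<and> K n \<subseteq> - {c}" if "b \<noteq> c"
        using K(2)[of "- {c}" b] that by auto
      ultimately show "b = c" by blast
    qed
    show "(x p, y p) \<in> g" if "p \<in> S" for p
      using D(2)[OF that] by (auto simp: g_def)
  qed
qed

section \<open>Countable unions of Borel graphs and small tuples\<close>

definition countably_single_valued :: "('z::topological_space \<times> 'w::topological_space) set \<Rightarrow> bool" where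
  "countably_single_valued H \<longleftrightarrow> (\<exists>\<G>. countable \<G> \<and> (\<forall>g\<in>\<G>. g \<in> sets (borel \<Otimes>\<^sub>M borel) \<and> single_valued g) \<and> H = \<Union>\<G>)"

lemma countably_single_valued_UN:
  assumes "countable I" "\<And>i. i \<in> I \<Longrightarrow> countably_single_valued (H i)"
  shows "countably_single_valued (\<Union>i\<in>I. H i)"
proof -
  obtain \<G> where \<G>: "\<And>i. i \<in> I \<Longrightarrow> countable (\<G> i)"
      "\<And>i g. i \<in> I \<Longrightarrow> g \<in> \<G> i \<Longrightarrow> g \<in> sets (borel \<Otimes>\<^sub>M borel) \<and> single_valued g"
      "\<And>i. i \<in> I \<Longrightarrow> H i = \<Union>(\<G> i)"
    using assms(2) unfolding countably_single_valued_def by metis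
  have "countable (\<Union>i\<in>I. \<G> i)" using assms(1) \<G>(1) by (intro countable_UN)
  moreover have "(\<Union>i\<in>I. H i) = \<Union>(\<Union>i\<in>I. \<G> i)" using \<G>(3) by auto
  ultimately show ?thesis unfolding countably_single_valued_def using \<G>(2)
    by (intro exI[of _ "\<Union>i\<in>I. \<G> i"] conjI ballI) auto
qed

lemma countably_single_valued_Un:
  assumes "countably_single_valued H" "countably_single_valued H'"
  shows "countably_single_valued (H \<union> H')"
proof -
  have "countably_single_valued (\<Union>b\<in>{True, False}. if b then H else H')"
    using assms by (intro countably_single_valued_UN) auto
  then show ?thesis by (simp add: Un_commute)
qed

lemma countably_single_valued_single:
  assumes "g \<in> sets (borel \<Otimes>\<^sub>M borel)" "single_valued g"
  shows "countably_single_valued g"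
  unfolding countably_single_valued_def
proof (intro exI conjI ballI)
  show "countable {g}" "g = \<Union>{g}" by simp_all
  show "h \<in> sets (borel \<Otimes>\<^sub>M borel)" "single_valued h" if "h \<in> {g}" for h
    using assms that by simp_all
qed

lemma countably_single_valued_borel:
  assumes "countably_single_valued H"
  shows "H \<in> sets (borel \<Otimes>\<^sub>M borel)"
proof -
  obtain \<G> where "countable \<G>" "\<forall>g\<in>\<G>. g \<in> sets (borel \<Otimes>\<^sub>M borel) \<and> single_valued g" "H = \<Union>\<G>"
    using assms unfolding countably_single_valued_def by (elim exE conjE)
  then show ?thesis by (simp only:) (intro sets.countable_Union subsetI, blast+)
qed

text \<open>
  A tuple of parameter sets \<open>C 0, \<dots>, C (m - 1)\<close> is small if its fibre product over \<open>x\<close> is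
  covered by countably many conditions "the \<open>i\<close>-th point lies on a fixed Borel graph".
  For \<open>m = 1\<close> this is the conclusion of the Lusin--Novikov theorem. Smallness passes to countable
  unions, and the doubling step below keeps non-small tuples non-small, so a non-small set
  produces a Cantor set of distinct \<open>y\<close>-values over a single \<open>x\<close>.
\<close>

definition small_family ::
    "('p \<Rightarrow> 'z::topological_space) \<Rightarrow> ('p \<Rightarrow> 'w::topological_space) \<Rightarrow> nat \<Rightarrow> (nat \<Rightarrow> 'p set) \<Rightarrow> bool" where
  "small_family x y m C \<longleftrightarrow> (\<exists>H. countably_single_valued H \<and>
     (\<forall>w. (\<forall>i<m. w i \<in> C i) \<longrightarrow> (\<forall>i<m. x (w i) = x (w 0)) \<longrightarrow> (\<exists>i<m. (x (w i), y (w i)) \<in> H)))"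

text \<open>
  After removing \<open>H\<close> no two tuples over the same point differ in every coordinate, so over each
  point some coordinate has at most one value. Separating the sets of points where the \<open>i\<close>-th
  coordinate has two values yields Borel sets on whose complements that coordinate is a function.
\<close>

lemma small_family_split:
  fixes x :: "'p::{complete_space, second_countable_topology} \<Rightarrow> 'z::{t2_space, second_countable_topology}"
    and y :: "'p \<Rightarrow> 'w::{metric_space, second_countable_topology}"
  assumes C: "\<And>i. closed (C i)" and x: "continuous_on UNIV x" and y: "continuous_on UNIV y"
    and H: "countably_single_valued H"
    and split: "\<And>w. (\<forall>i<m. w i \<in> C i \<and> w (i + m) \<in> C i) \<Longrightarrow> (\<forall>i<m + m. x (w i) = x (w 0)) \<Longrightarrow>
       (\<forall>i<m. y (w i) \<noteq> y (w (i + m))) \<Longrightarrow> \<exists>i<m + m. (x (w i), y (w i)) \<in> H"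
  shows "small_family x y m C"
proof -
  have xm: "x \<in> borel_measurable borel" using x by (rule borel_measurable_continuous_onI)
  have ym: "y \<in> borel_measurable borel" using y by (rule borel_measurable_continuous_onI)
  have "(\<lambda>p. (x p, y p)) \<in> borel \<rightarrow>\<^sub>M borel \<Otimes>\<^sub>M borel" using xm ym by simp
  from measurable_sets[OF this countably_single_valued_borel[OF H]]
  have Hb: "{p. (x p, y p) \<in> H} \<in> sets borel" by (simp add: vimage_def)
  \<comment> \<open>Points already covered by \<open>H\<close> are discarded, so that the conclusion
    of \<open>split\<close> becomes contradictory.\<close>
  define A where "A i = C i \<inter> {p. (x p, y p) \<notin> H}" for i
  have A: "A i \<in> sets borel" for i
  proof -
    have "A i = C i - {p. (x p, y p) \<in> H}" by (auto simp: A_def)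
    then show ?thesis using C[of i] Hb by auto
  qed
  \<comment> \<open>Pairs witnessing that coordinate \<open>i\<close> takes two values over one
    point.\<close>
  define S where "S i = (A i \<times> A i) \<inter> {pq. x (fst pq) = x (snd pq)} \<inter> - {pq. y (fst pq) = y (snd pq)}" for i
  have cx: "continuous_on UNIV (\<lambda>pq::'p \<times> 'p. x (fst pq))" "continuous_on UNIV (\<lambda>pq::'p \<times> 'p. x (snd pq))"
    by (auto intro!: continuous_on_compose2[OF x] continuous_intros)
  have cy: "continuous_on UNIV (\<lambda>pq::'p \<times> 'p. y (fst pq))" "continuous_on UNIV (\<lambda>pq::'p \<times> 'p. y (snd pq))"
    by (auto intro!: continuous_on_compose2[OF y] continuous_intros)
  have S: "S i \<in> sets borel" for i
  proof -
    have "A i \<times> A i \<in> sets (borel :: ('p \<times> 'p) measure)" using A[of i]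
      by (simp add: borel_prod[symmetric])
    moreover have "{pq. x (fst pq) = x (snd pq)} \<in> sets (borel :: ('p \<times> 'p) measure)"
      using cx by (intro borel_closed closed_Collect_eq)
    moreover have "- {pq. y (fst pq) = y (snd pq)} \<in> sets (borel :: ('p \<times> 'p) measure)"
      using cy by (intro borel_comp borel_closed closed_Collect_eq)
    ultimately show ?thesis unfolding S_def by (intro sets.Int)
  qed
  have "(\<Inter>i<m. (\<lambda>pq. x (fst pq)) ` S i) = {}"
  proof (rule equals0I)
    fix a assume a: "a \<in> (\<Inter>i<m. (\<lambda>pq. x (fst pq)) ` S i)"
    have "\<exists>p q. p \<in> A i \<and> q \<in> A i \<and> x p = a \<and> x q = a \<and> y p \<noteq> y q" if "i < m" for i
    proof -
      have "a \<in> (\<lambda>pq. x (fst pq)) ` S i" using a that by blast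
      then obtain p q where "(p, q) \<in> S i" "x p = a" by fastforce
      then show ?thesis unfolding S_def by auto
    qed
    then obtain p q where pq: "\<And>i. i < m \<Longrightarrow> p i \<in> A i \<and> q i \<in> A i \<and> x (p i) = a \<and> x (q i) = a \<and> y (p i) \<noteq> y (q i)"
      by metis
    \<comment> \<open>The \<open>p i\<close> followed by the \<open>q i\<close>: by
      \<open>split\<close> this tuple meets \<open>H\<close>, although all its members avoid
      \<open>H\<close>.\<close>
    define w where "w i = (if i < m then p i else q (i - m))" for i
    have xw: "x (w i) = a" if "i < m + m" for i
      using that pq[of i] pq[of "i - m"] by (auto simp: w_def)
    have "(x (w i), y (w i)) \<notin> H" if "i < m + m" for i
    proof (cases "i < m")
      case True
      then show ?thesis using pq[of i] by (auto simp: w_def A_def)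
    next
      case False
      then have "i - m < m" using that by linarith
      then show ?thesis using pq[of "i - m"] False by (auto simp: w_def A_def)
    qed
    moreover have "\<exists>i<m + m. (x (w i), y (w i)) \<in> H"
    proof (rule split)
      show "\<forall>i<m. w i \<in> C i \<and> w (i + m) \<in> C i" using pq by (auto simp: w_def A_def)
      show "\<forall>i<m. y (w i) \<noteq> y (w (i + m))" using pq by (auto simp: w_def)
      show "\<forall>i<m + m. x (w i) = x (w 0)"
      proof (intro allI impI)
        fix i assume "i < m + m"
        then show "x (w i) = x (w 0)" using xw[of i] xw[of 0] by auto
      qed
    qed
    ultimately show False by blast
  qed
  from lusin_separation[OF S cx(1) this]
  obtain B where B: "\<And>i. i < m \<Longrightarrow> B i \<in> sets borel" 
     "\<And>i. i < m \<Longrightarrow> (\<lambda>pq. x (fst pq)) ` S i \<subseteq> B i" "(\<Inter>i<m. B i) = {}"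
    by metis
  \<comment> \<open>Over the complement of \<open>B i\<close> no pair of \<open>S i\<close> remains,
    so there \<open>y\<close> is a function of \<open>x\<close>.\<close>
  define Q where "Q i = A i \<inter> x -` (- B i)" for i
  have "\<exists>g. g \<in> sets (borel \<Otimes>\<^sub>M borel) \<and> single_valued g \<and> (\<forall>p\<in>Q i. (x p, y p) \<in> g)" if "i < m" for i
  proof -
    have "x -` (- B i) \<in> sets borel" using B(1)[OF that] xm
      by (intro measurable_sets_borel) auto
    then have "Q i \<in> sets borel" using A by (auto simp: Q_def)
    moreover have "y p = y q" if pq: "p \<in> Q i" "q \<in> Q i" "x p = x q" for p q
    proof (rule ccontr)
      assume "y p \<noteq> y q"
      then have "(p, q) \<in> S i" using pq by (auto simp: S_def Q_def)
      then have "x p \<in> B i" using B(2)[OF \<open>i < m\<close>] by force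
      then show False using pq(1) by (simp add: Q_def)
    qed
    ultimately obtain g where "g \<in> sets (borel \<Otimes>\<^sub>M borel)" "single_valued g" "\<And>p. p \<in> Q i \<Longrightarrow> (x p, y p) \<in> g"
      by (rule borel_single_valued_cover[OF _ x y]) blast+
    then show ?thesis by blast
  qed
  then obtain g where g: "\<And>i. i < m \<Longrightarrow> g i \<in> sets (borel \<Otimes>\<^sub>M borel)" "\<And>i. i < m \<Longrightarrow> single_valued (g i)"
    "\<And>i p. i < m \<Longrightarrow> p \<in> Q i \<Longrightarrow> (x p, y p) \<in> g i" by metis
  have "countably_single_valued (H \<union> (\<Union>i\<in>{..<m}. g i))"
    using g(1,2) by (intro countably_single_valued_Un H countably_single_valued_UN countably_single_valued_single) auto
  moreover have "\<exists>i<m. (x (w i), y (w i)) \<in> H \<union> (\<Union>i\<in>{..<m}. g i)"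
    if w: "\<forall>i<m. w i \<in> C i" "\<forall>i<m. x (w i) = x (w 0)" for w
  proof -
    \<comment> \<open>The \<open>B i\<close> have no common point, so the base point of the tuple
      lies off some \<open>B i\<close>; at that coordinate the tuple is caught by \<open>H\<close>
      or by \<open>g i\<close>.\<close>
    obtain i where i: "i < m" "x (w 0) \<notin> B i" using B(3) by blast
    then have xi: "x (w i) \<notin> B i" using w(2) by metis
    show ?thesis
    proof (cases "(x (w i), y (w i)) \<in> H")
      case False
      then have "w i \<in> Q i" using w(1) i(1) xi by (simp add: Q_def A_def)
      then show ?thesis using g(3) i(1) by blast
    qed (use i(1) in blast)
  qed
  ultimately show ?thesis unfolding small_family_def by blast
qed

text \<open>If no refinement were large, all the countably many \<open>D J\<close> would be small.
  The union of their covers \<open>H J\<close> catches every two tuples over one point that differ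
  in all coordinates, because such tuples can be enclosed in small pieces with disjoint
  \<open>y\<close>-images. This is the hypothesis of \<open>small_family_split\<close>.\<close>

lemma not_small_family_refine:
  fixes x :: "'p::{complete_space, second_countable_topology} \<Rightarrow> 'z::{t2_space, second_countable_topology}"
    and y :: "'p \<Rightarrow> 'w::{metric_space, second_countable_topology}"
  assumes C: "\<And>i. closed (C i)" and x: "continuous_on UNIV x" and y: "continuous_on UNIV y"
    and large: "\<not> small_family x y m C" and e: "e > 0"
  shows "\<exists>C'. (\<forall>i. closed (C' i)) \<and> \<not> small_family x y (m + m) C' \<and>
     (\<forall>i<m. C' i \<subseteq> C i \<and> C' (i + m) \<subseteq> C i \<and> (\<forall>p\<in>C' i. \<forall>q\<in>C' (i + m). y p \<noteq> y q)) \<and>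
     (\<forall>i<m + m. \<forall>p\<in>C' i. \<forall>q\<in>C' i. dist p q < e)"
proof (rule ccontr)
  assume contra: "\<not> ?thesis"
  obtain K :: "nat \<Rightarrow> 'p set" where K: "\<And>n. closed (K n)"
    "\<And>U w. open U \<Longrightarrow> w \<in> U \<Longrightarrow> \<exists>n. w \<in> K n \<and> K n \<subseteq> U"
    using countable_closed_nbhds by blast
  \<comment> \<open>Positions \<open>i\<close> and \<open>i + m\<close> are the two children of
    \<open>C i\<close>; hence the subtraction.\<close>
  define D where "D J i = C (if i < m then i else i - m) \<inter> K (J i)" for J :: "nat \<Rightarrow> nat" and i
  define I where "I = {J \<in> PiE {..<m + m} (\<lambda>_. UNIV :: nat set).
      (\<forall>i<m. \<forall>p\<in>K (J i). \<forall>q\<in>K (J (i + m)). y p \<noteq> y q) \<and>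
      (\<forall>i<m + m. \<forall>p\<in>K (J i). \<forall>q\<in>K (J i). dist p q < e)}"
  have cI: "countable I" unfolding I_def
    by (rule countable_subset[of _ "PiE {..<m + m} (\<lambda>_. UNIV :: nat set)"])
      (auto intro: countable_PiE)
  have "small_family x y (m + m) (D J)" if J: "J \<in> I" for J
  proof (rule ccontr)
    assume "\<not> small_family x y (m + m) (D J)"
    moreover have "\<forall>i. closed (D J i)" using C K(1) by (auto simp: D_def)
    moreover have "\<forall>i<m. D J i \<subseteq> C i \<and> D J (i + m) \<subseteq> C i \<and> (\<forall>p\<in>D J i. \<forall>q\<in>D J (i + m). y p \<noteq> y q)"
      using J by (auto simp: D_def I_def)
    moreover have "\<forall>i<m + m. \<forall>p\<in>D J i. \<forall>q\<in>D J i. dist p q < e"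
      using J by (auto simp: D_def I_def)
    ultimately show False using contra by blast
  qed
  then obtain H where H: "\<And>J. J \<in> I \<Longrightarrow> countably_single_valued (H J)"
     "\<And>J w. J \<in> I \<Longrightarrow> \<forall>i<m + m. w i \<in> D J i \<Longrightarrow> \<forall>i<m + m. x (w i) = x (w 0) \<Longrightarrow> \<exists>i<m + m. (x (w i), y (w i)) \<in> H J"
    unfolding small_family_def by metis
  have "small_family x y m C"
  proof (rule small_family_split[OF C x y])
    show "countably_single_valued (\<Union>J\<in>I. H J)"
      using cI H(1) by (rule countably_single_valued_UN)
    fix w assume w: "\<forall>i<m. w i \<in> C i \<and> w (i + m) \<in> C i" "\<forall>i<m + m. x (w i) = x (w 0)"
      "\<forall>i<m. y (w i) \<noteq> y (w (i + m))"
    have nbhd: "\<exists>k. p \<in> K k \<and> K k \<subseteq> y -` U \<and> (\<forall>p\<in>K k. \<forall>q\<in>K k. dist p q < e)"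
      if "open U" "y p \<in> U" for p U
    proof -
      have "open (y -` U \<inter> ball p (e/2))" using y that(1)
        by (intro open_Int) (auto simp: continuous_on_open_vimage)
      moreover have "p \<in> y -` U \<inter> ball p (e/2)" using that(2) e by simp
      ultimately obtain k where k: "p \<in> K k" "K k \<subseteq> y -` U \<inter> ball p (e/2)"
        using K(2) by blast
      have "dist r q < e" if "r \<in> K k" "q \<in> K k" for r q
        using k(2) that dist_triangle_half_r[of p r e q] by (auto simp: subset_iff)
      then show ?thesis using k by blast
    qed
    have "\<exists>k l. w i \<in> K k \<and> w (i + m) \<in> K l \<and> (\<forall>p\<in>K k. \<forall>q\<in>K l. y p \<noteq> y q) \<and>
       (\<forall>p\<in>K k. \<forall>q\<in>K k. dist p q < e) \<and> (\<forall>p\<in>K l. \<forall>q\<in>K l. dist p q < e)" if "i < m" for i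
    proof -
      have "y (w i) \<noteq> y (w (i + m))" using w(3) that by blast
      obtain U V where UV: "open U" "open V" "y (w i) \<in> U" "y (w (i + m)) \<in> V" "U \<inter> V = {}"
        using hausdorff[OF \<open>y (w i) \<noteq> y (w (i + m))\<close>] by blast
      obtain k where k: "w i \<in> K k" "K k \<subseteq> y -` U" "\<forall>p\<in>K k. \<forall>q\<in>K k. dist p q < e"
        using nbhd[OF UV(1,3)] by blast
      obtain l where l: "w (i + m) \<in> K l" "K l \<subseteq> y -` V" "\<forall>p\<in>K l. \<forall>q\<in>K l. dist p q < e"
        using nbhd[OF UV(2,4)] by blast
      have "\<forall>p\<in>K k. \<forall>q\<in>K l. y p \<noteq> y q" using k(2) l(2) UV(5) by fastforce
      then show ?thesis using k l by blast
    qed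
    then obtain k l where kl: "\<And>i. i < m \<Longrightarrow> w i \<in> K (k i) \<and> w (i + m) \<in> K (l i) \<and> 
       (\<forall>p\<in>K (k i). \<forall>q\<in>K (l i). y p \<noteq> y q) \<and>
       (\<forall>p\<in>K (k i). \<forall>q\<in>K (k i). dist p q < e) \<and> (\<forall>p\<in>K (l i). \<forall>q\<in>K (l i). dist p q < e)" by metis
    define J where "J = restrict (\<lambda>i. if i < m then k i else l (i - m)) {..<m + m}"
    have lt: "i - m < m" if "i < m + m" "\<not> i < m" for i using that by linarith
    have "J \<in> I" unfolding I_def
    proof (intro CollectI conjI)
      show "J \<in> PiE {..<m + m} (\<lambda>_. UNIV)" by (simp add: J_def)
      show "\<forall>i<m. \<forall>p\<in>K (J i). \<forall>q\<in>K (J (i + m)). y p \<noteq> y q"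
        using kl by (simp add: J_def)
      show "\<forall>i<m + m. \<forall>p\<in>K (J i). \<forall>q\<in>K (J i). dist p q < e"
      proof (intro allI impI)
        fix i assume "i < m + m"
        then show "\<forall>p\<in>K (J i). \<forall>q\<in>K (J i). dist p q < e"
          using kl[of i] kl[OF lt[of i]] by (cases "i < m") (simp_all add: J_def)
      qed
    qed
    moreover have "\<forall>i<m + m. w i \<in> D J i"
    proof (intro allI impI)
      fix i assume i: "i < m + m"
      show "w i \<in> D J i"
      proof (cases "i < m")
        case True
        then show ?thesis using kl[of i] w(1) by (simp add: D_def J_def)
      next
        case False
        then have "w i \<in> C (i - m)" "w i \<in> K (l (i - m))"
          using kl[OF lt[OF i False]] w(1) lt[OF i False] 
            add.commute le_add_diff_inverse linorder_not_less by metis+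
        then show ?thesis using False i by (simp add: D_def J_def)
      qed
    qed
    ultimately have "\<exists>i<m + m. (x (w i), y (w i)) \<in> H J"
      using w(2) by (intro H(2))
    then show "\<exists>i<m + m. (x (w i), y (w i)) \<in> (\<Union>J\<in>I. H J)"
      using \<open>J \<in> I\<close> by blast
  qed
  then show False using large by blast
qed

text \<open>A Cantor scheme: repeated doubling of \<open>F\<close> gives closed sets of shrinking
  diameter with separated \<open>y\<close>-values, and each branch converges to a point. Keeping all
  \<open>2 ^ n\<close> sets of a level jointly large, rather than each one separately, puts all the
  limits over a common \<open>x\<close>-value.\<close>

lemma uncountable_section:
  fixes x :: "'p::{complete_space, second_countable_topology} \<Rightarrow> 'z::{t2_space, second_countable_topology}"
    and y :: "'p \<Rightarrow> 'w::{metric_space, second_countable_topology}"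
  assumes F: "closed F" and x: "continuous_on UNIV x" and y: "continuous_on UNIV y"
    and large: "\<not> small_family x y 1 (\<lambda>_. F)"
  shows "\<exists>a. uncountable (y ` {p \<in> F. x p = a})"
proof -
  let ?R = "\<lambda>n::nat. \<lambda>C C'. \<forall>i<2 ^ n. C' i \<subseteq> C i \<and> C' (i + 2 ^ n) \<subseteq> C i \<and> (\<forall>p\<in>C' i. \<forall>q\<in>C' (i + 2 ^ n). y p \<noteq> y q)"
  let ?D = "\<lambda>n::nat. \<lambda>C'. \<forall>i<2 ^ Suc n. \<forall>p\<in>C' i. \<forall>q\<in>C' i. dist p q < inverse (Suc n)"
  have "\<exists>S. \<forall>n. (((\<forall>i. closed (S n i)) \<and> \<not> small_family x y (2 ^ n) (S n)) \<and> (n = 0 \<longrightarrow> S n = (\<lambda>_. F))) \<and>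
     (?R n (S n) (S (Suc n)) \<and> ?D n (S (Suc n)))"
  proof (rule dependent_nat_choice, goal_cases)
    case 1
    then show ?case using F large by (intro exI[of _ "\<lambda>_. F"]) simp
  next
    case (2 T n)
    have "\<exists>C'. (\<forall>i. closed (C' i)) \<and> \<not> small_family x y (2 ^ n + 2 ^ n) C' \<and> ?R n T C' \<and>
       (\<forall>i<2 ^ n + 2 ^ n. \<forall>p\<in>C' i. \<forall>q\<in>C' i. dist p q < inverse (Suc n))"
      using 2 by (intro not_small_family_refine x y) auto
    moreover have "(2::nat) ^ n + 2 ^ n = 2 ^ Suc n" by simp
    ultimately show ?case by (simp only:) blast
  qed
  then obtain S where S': "\<forall>n. (((\<forall>i. closed (S n i)) \<and> \<not> small_family x y (2 ^ n) (S n)) \<and> (n = 0 \<longrightarrow> S n = (\<lambda>_. F))) \<and>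
     (?R n (S n) (S (Suc n)) \<and> ?D n (S (Suc n)))"
    by (rule exE)
  have S_closed: "closed (S n i)" for n i using S'[rule_format, of n] by blast
  have S_large: "\<not> small_family x y (2 ^ n) (S n)" for n using S'[rule_format, of n] by blast
  have S0: "S 0 = (\<lambda>_. F)" using S'[rule_format, of 0] by blast
  have S_step: "?R n (S n) (S (Suc n))" for n using S'[rule_format, of n] by (rule conjunct2[THEN conjunct1])
  have S_diam: "?D n (S (Suc n))" for n using S'[rule_format, of n] by (rule conjunct2[THEN conjunct2])

  \<comment> \<open>node \<open>i\<close> of level \<open>n\<close> has the children \<open>i\<close> and \<open>i + 2 ^ n\<close>, so the branch of \<open>A\<close> passes
    through the binary number with digit set \<open>A \<inter> {..<n}\<close>\<close>
  define idx :: "nat set \<Rightarrow> nat \<Rightarrow> nat" where "idx A = rec_nat 0 (\<lambda>n i. if n \<in> A then i + 2 ^ n else i)" for A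
  have idx_0: "idx A 0 = 0" and idx_Suc: "idx A (Suc n) = (if n \<in> A then idx A n + 2 ^ n else idx A n)" for A n
    by (simp_all add: idx_def)
  have idx_less: "idx A n < 2 ^ n" for A n
    by (induction n) (auto simp: idx_0 idx_Suc)
  have idx_cong: "idx A n = idx B n" if "\<And>k. k < n \<Longrightarrow> k \<in> A \<longleftrightarrow> k \<in> B" for A B n
    using that by (induction n) (auto simp: idx_0 idx_Suc)
  define T where "T A n = S n (idx A n)" for A n
  have T_Suc: "T A (Suc n) \<subseteq> T A n" for A n
    using S_step[of n, rule_format, OF idx_less[of A n]] by (auto simp: T_def idx_Suc)
  have T_dec: "T A n \<subseteq> T A k" if "k \<le> n" for A n k
    by (rule lift_Suc_antimono_le[of "T A", OF T_Suc that])
  have T_small: "\<exists>n. \<forall>p\<in>T A n. \<forall>q\<in>T A n. dist p q < e" if "e > 0" for A e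
  proof -
    obtain n where n: "inverse (real (Suc n)) < e" using reals_Archimedean \<open>e > 0\<close> by blast
    have "\<forall>p\<in>T A (Suc n). \<forall>q\<in>T A (Suc n). dist p q < inverse (Suc n)"
      using S_diam[of n, rule_format, OF idx_less[of A "Suc n"]] by (simp add: T_def)
    then show ?thesis using n less_trans by blast
  qed
  \<comment> \<open>Non-smallness, tested against the empty \<open>H\<close>, yields a point of the
    fibre product.\<close>
  have tuple: "\<exists>w. (\<forall>i<2 ^ n. w i \<in> S n i) \<and> (\<forall>i<2 ^ n. x (w i) = x (w 0))" for n
  proof (rule ccontr)
    assume "\<not> ?thesis"
    moreover have "countably_single_valued ({} :: ('z \<times> 'w) set)"
      by (intro countably_single_valued_single) (auto simp: single_valued_def)
    ultimately show False using S_large[of n] unfolding small_family_def by blast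
  qed
  have "\<exists>p. \<forall>n. p \<in> T A n" for A
  proof -
    have ne: "T A n \<noteq> {}" for n using tuple[of n] idx_less[of A n] by (auto simp: T_def)
    have cl: "closed (T A n)" for n by (simp add: T_def S_closed)
    from decreasing_closed_nest[of "T A", OF cl ne T_dec T_small] show ?thesis by metis
  qed
  then obtain p where p: "\<And>A n. p A \<in> T A n" by metis
  have x_const: "x (p A) = x (p {})" for A
  proof (rule ccontr)
    assume "x (p A) \<noteq> x (p {})"
    then obtain U V where UV: "open U" "open V" "x (p A) \<in> U" "x (p {}) \<in> V" "U \<inter> V = {}"
      using hausdorff by metis
    have ev: "\<exists>n. T B n \<subseteq> x -` W" if "open W" "x (p B) \<in> W" for B W
    proof -
      have "open (x -` W)" using x that(1) by (simp add: continuous_on_open_vimage)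
      moreover have "p B \<in> x -` W" using that(2) by simp
      ultimately obtain e where e: "e > 0" "ball (p B) e \<subseteq> x -` W" using openE by blast
      obtain n where "\<forall>q\<in>T B n. \<forall>r\<in>T B n. dist q r < e" using T_small e(1) by blast
      then have "T B n \<subseteq> ball (p B) e" using p[of B n] by (simp add: subset_eq)
      then show ?thesis using e(2) by blast
    qed
    obtain n1 n2 where "T A n1 \<subseteq> x -` U" "T {} n2 \<subseteq> x -` V"
      using ev[OF UV(1,3)] ev[OF UV(2,4)] by blast
    then have sub: "T A (max n1 n2) \<subseteq> x -` U" "T {} (max n1 n2) \<subseteq> x -` V"
      using T_dec[of n1 "max n1 n2" A] T_dec[of n2 "max n1 n2" "{}"] by auto
    \<comment> \<open>One tuple has members in both branches at this level, so its common
      \<open>x\<close>-value would lie in both \<open>U\<close> and \<open>V\<close>.\<close>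
    obtain w where w: "\<forall>i<2 ^ max n1 n2. w i \<in> S (max n1 n2) i" "\<forall>i<2 ^ max n1 n2. x (w i) = x (w 0)"
      using tuple by blast
    have "x (w 0) \<in> W" if "T B (max n1 n2) \<subseteq> x -` W" for B W
    proof -
      have "w (idx B (max n1 n2)) \<in> x -` W" using that w(1) idx_less unfolding T_def by blast
      moreover have "x (w (idx B (max n1 n2))) = x (w 0)" using w(2) idx_less by blast
      ultimately show ?thesis by simp
    qed
    then show False using sub UV(5) by blast
  qed
  have inj: "inj (\<lambda>A. y (p A))"
  proof (rule injI, rule ccontr)
    fix A B assume eq: "y (p A) = y (p B)" and "A \<noteq> B"
    \<comment> \<open>At the first digit where \<open>A\<close> and \<open>B\<close> differ, the
      branches leave a common node for its two children.\<close>
    define n where "n = (LEAST n. (n \<in> A) \<noteq> (n \<in> B))"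
    have "\<exists>n. (n \<in> A) \<noteq> (n \<in> B)" using \<open>A \<noteq> B\<close> by blast
    then have n: "(n \<in> A) \<noteq> (n \<in> B)" unfolding n_def by (rule LeastI_ex)
    have "k \<in> A \<longleftrightarrow> k \<in> B" if "k < n" for k
      using not_less_Least[of k "\<lambda>n. (n \<in> A) \<noteq> (n \<in> B)"] that unfolding n_def by blast
    then have i: "idx A n = idx B n" by (rule idx_cong)
    have sep: "y q \<noteq> y r" if "q \<in> S (Suc n) (idx A n)" "r \<in> S (Suc n) (idx A n + 2 ^ n)" for q r
      using S_step[of n, rule_format, OF idx_less[of A n]] that by blast
    have pAB: "p A \<in> S (Suc n) (idx A (Suc n))" "p B \<in> S (Suc n) (idx B (Suc n))"
      using p[of A "Suc n"] p[of B "Suc n"] by (simp_all add: T_def)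
    show False
    proof (cases "n \<in> A")
      case True
      then show False using sep[of "p B" "p A"] pAB n i eq by (simp add: idx_Suc)
    next
      case False
      then show False using sep[of "p A" "p B"] pAB n i eq by (simp add: idx_Suc)
    qed
  qed
  have "p A \<in> F" for A using p[of A 0] by (simp add: T_def S0)
  then have sub: "range (\<lambda>A. y (p A)) \<subseteq> y ` {q \<in> F. x q = x (p {})}" using x_const by auto
  have "\<not> countable (UNIV :: nat set set)"
    using nat_sets_eqpoll_reals uncountable_UNIV_real countable_eqpoll eqpoll_sym by metis
  then have "\<not> countable (range (\<lambda>A. y (p A)))"
    using inj countable_image_inj_eq by blast
  then show ?thesis using sub countable_subset by blast
qed

text \<open>The sections of \<open>P\<close> are the \<open>?y\<close>-images of the fibres of
  \<open>F\<close>, so their countability excludes the Cantor scheme and \<open>F\<close> is small;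
  for \<open>m = 1\<close> smallness is the required covering.\<close>

theorem lusin_novikov:
  fixes P :: "('z::{complete_space, second_countable_topology} \<times> 'w::{complete_space, second_countable_topology}) set"
  assumes P: "P \<in> sets (borel \<Otimes>\<^sub>M borel)" and sec: "\<And>a. countable {b. (a, b) \<in> P}"
  obtains g where "\<And>n::nat. g n \<in> sets (borel \<Otimes>\<^sub>M borel)" "\<And>n. single_valued (g n)" "P \<subseteq> (\<Union>n. g n)"
proof -
  obtain F :: "(('z \<times> 'w) \<times> (nat \<Rightarrow> real)) set" where F: "closed F" "P = fst ` F"
    using borel_eq_fst_image_closed P by (metis borel_prod)
  let ?x = "\<lambda>p::('z \<times> 'w) \<times> (nat \<Rightarrow> real). fst (fst p)" and ?y = "\<lambda>p::('z \<times> 'w) \<times> (nat \<Rightarrow> real). snd (fst p)"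
  have small: "small_family ?x ?y 1 (\<lambda>_. F)"
  proof (rule ccontr)
    assume "\<not> small_family ?x ?y 1 (\<lambda>_. F)"
    moreover have "continuous_on UNIV ?x" "continuous_on UNIV ?y" by (intro continuous_intros)+
    ultimately obtain a where a: "uncountable (?y ` {p \<in> F. ?x p = a})"
      using uncountable_section[OF F(1), of ?x ?y] by blast
    have "?y ` {p \<in> F. ?x p = a} \<subseteq> {b. (a, b) \<in> P}" using F(2) by force
    then show False using a sec countable_subset by blast
  qed
  then obtain H where H: "countably_single_valued H"
     "\<And>w. (\<forall>i<1. w i \<in> F) \<Longrightarrow> (\<forall>i<1. ?x (w i) = ?x (w (0::nat))) \<Longrightarrow> (\<exists>i<1. (?x (w i), ?y (w i)) \<in> H)"
    unfolding small_family_def by metis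
  have PH: "P \<subseteq> H"
  proof
    fix z assume "z \<in> P"
    then obtain p where "p \<in> F" "z = fst p" using F(2) by blast
    then show "z \<in> H" using H(2)[of "\<lambda>_. p"] by simp
  qed
  obtain \<G> where \<G>: "countable \<G>" "\<forall>g\<in>\<G>. g \<in> sets (borel \<Otimes>\<^sub>M borel) \<and> single_valued g" "H = \<Union>\<G>"
    using H(1) unfolding countably_single_valued_def by (elim exE conjE)
  \<comment> \<open>The empty graph is added so that the family can be enumerated even when it is
    empty.\<close>
  define \<G>' where "\<G>' = insert {} \<G>"
  have c: "countable \<G>'" "\<G>' \<noteq> {}" using \<G>(1) by (auto simp: \<G>'_def)
  have g: "from_nat_into \<G>' n \<in> \<G>'" for n using c(2) by (rule from_nat_into)
  show thesis
  proof (rule that[of "from_nat_into \<G>'"])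
    show "from_nat_into \<G>' n \<in> sets (borel \<Otimes>\<^sub>M borel)" "single_valued (from_nat_into \<G>' n)" for n
      using g[of n] \<G>(2) unfolding \<G>'_def by (auto simp: single_valued_def)
    have "P \<subseteq> \<Union>\<G>'" using PH \<G>(3) by (auto simp: \<G>'_def)
    then show "P \<subseteq> (\<Union>n. from_nat_into \<G>' n)" using range_from_nat_into[OF c(2,1)] by simp
  qed
qed

section \<open>Exhaustion by locally finite Borel graphs\<close>

text \<open>\<open>lusin_novikov\<close> speaks of types with a complete metric, whereas
  \<open>M\<close> has an arbitrary carrier. Points are coded by their distances to a dense
  sequence; through the Borel left inverse \<open>r\<close>, relations on \<open>M\<close> are
  pulled back to codes.\<close>

lemma standard_borel_retract:
  fixes M :: "'a measure"
  assumes "standard_borel M" "space M \<noteq> {}"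
  obtains \<iota> :: "'a \<Rightarrow> nat \<Rightarrow> real" and r
  where "\<iota> \<in> M \<rightarrow>\<^sub>M borel" "r \<in> borel \<rightarrow>\<^sub>M M" "\<And>x. x \<in> space M \<Longrightarrow> r (\<iota> x) = x" "\<iota> ` space M \<in> sets borel"
proof -
  obtain T where T: "completely_metrizable_space T" "separable_space T" "topspace T = space M"
     "sets M = sigma_sets (space M) {U. openin T U}"
    using assms(1) unfolding standard_borel_def by blast
  obtain X d where X: "Metric_space X d" "Metric_space.mcomplete X d" "T = Metric_space.mtopology X d"
    using T(1) unfolding completely_metrizable_space_def by blast
  interpret Metric_space X d by (rule X(1))
  have space: "space M = X" using T(3) X(3) by simp
  obtain D where D: "countable D" "D \<subseteq> X" "mtopology closure_of D = X"
    using T(2) unfolding separable_space_def X(3) by auto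
  have dense: "\<exists>e\<in>D. d x e < s" if "x \<in> X" "s > 0" for x s
  proof -
    have "x \<in> mtopology closure_of D" using D(3) that(1) by simp
    then show ?thesis using that(2) unfolding metric_closure_of by auto
  qed
  have "D \<noteq> {}" using assms(2) dense[of _ 1] space by auto
  define e where "e = from_nat_into D"
  have e: "e n \<in> X" for n using from_nat_into[OF \<open>D \<noteq> {}\<close>] D(2) by (auto simp: e_def)
  have e_dense: "\<exists>n. d x (e n) < s" if "x \<in> X" "s > 0" for x s
    using dense[OF that] from_nat_into_surj[OF D(1)] unfolding e_def by metis
  have open_sets: "U \<in> sets M" if "openin mtopology U" for U
    unfolding T(4) using that X(3) by (intro sigma_sets.Basic) simp
  define \<iota> where "\<iota> x = (\<lambda>n. d x (e n))" for x
  have \<iota>_meas: "\<iota> \<in> M \<rightarrow>\<^sub>M borel"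
  proof (rule measurable_coordinatewise_then_product)
    fix n
    show "(\<lambda>x. \<iota> x n) \<in> M \<rightarrow>\<^sub>M borel"
    proof (rule borel_measurableI_less)
      fix q
      have "{x \<in> space M. \<iota> x n < q} = mball (e n) q"
        using e by (auto simp: space \<iota>_def commute)
      then show "{x \<in> space M. \<iota> x n < q} \<in> sets M"
        using open_sets[OF openin_mball] by simp
    qed
  qed
  \<comment> \<open>the sequences of distances to a point of the completion, by Katetov's description;
    completeness makes all of them distances to a point of \<open>X\<close>\<close>
  define N where "N = {s :: nat \<Rightarrow> real. (\<forall>n m. d (e n) (e m) \<le> s n + s m \<and> s n \<le> s m + d (e n) (e m)) \<and>
     (\<forall>k. \<exists>n. s n < inverse (real (Suc k)))}"
  have coord: "(\<lambda>s :: nat \<Rightarrow> real. s n) \<in> borel_measurable borel" for n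
    by (rule borel_measurable_continuous_onI,
        rule continuous_on_product_then_coordinatewise, rule continuous_on_id)
  have N_borel: "N \<in> sets borel"
  proof -
    have le: "{s. f s \<le> g s} \<in> sets borel" if "f \<in> borel_measurable borel" "g \<in> borel_measurable borel"
      for f g :: "(nat \<Rightarrow> real) \<Rightarrow> real"
      using borel_measurable_le[OF that] by simp
    have lt: "{s. f s < g s} \<in> sets borel" if "f \<in> borel_measurable borel" "g \<in> borel_measurable borel"
      for f g :: "(nat \<Rightarrow> real) \<Rightarrow> real"
      using borel_measurable_less[OF that] by simp
    have "(\<Inter>n m. {s. d (e n) (e m) \<le> s n + s m} \<inter> {s. s n \<le> s m + d (e n) (e m)}) \<inter>
       (\<Inter>k. \<Union>n. {s. s n < inverse (real (Suc k))}) \<in> sets borel"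
      by (intro sets.Int sets.countable_INT'' sets.countable_UN'' le lt borel_measurable_add
          borel_measurable_const coord) auto
    moreover have "N = (\<Inter>n m. {s. d (e n) (e m) \<le> s n + s m} \<inter> {s. s n \<le> s m + d (e n) (e m)}) \<inter>
       (\<Inter>k. \<Union>n. {s. s n < inverse (real (Suc k))})"
      by (auto simp: N_def)
    ultimately show ?thesis by simp
  qed
  have image: "\<iota> ` X = N"
  proof
    show "\<iota> ` X \<subseteq> N"
    proof
      fix s assume "s \<in> \<iota> ` X"
      then obtain x where x: "x \<in> X" "s = \<iota> x" by blast
      have "d (e n) (e m) \<le> s n + s m" "s n \<le> s m + d (e n) (e m)" for n m
        using triangle[OF e x(1) e, of n m] triangle[OF x(1) e e, of n m]
        by (simp_all add: x(2) \<iota>_def commute)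
      moreover have "\<exists>n. s n < inverse (real (Suc k))" for k
        using e_dense[OF x(1)] by (simp add: x(2) \<iota>_def)
      ultimately show "s \<in> N" by (simp add: N_def)
    qed
    show "N \<subseteq> \<iota> ` X"
    proof
      fix s assume "s \<in> N"
      then have s: "\<And>n m. d (e n) (e m) \<le> s n + s m" "\<And>n m. s n \<le> s m + d (e n) (e m)"
         "\<And>k. \<exists>n. s n < inverse (real (Suc k))" by (auto simp: N_def)
      \<comment> \<open>\<open>c k\<close> picks a dense point that \<open>s\<close> claims to be
        closer than \<open>1 / (k + 1)\<close>; the first inequality in \<open>s\<close> makes these
        points a Cauchy sequence.\<close>
      obtain c where c: "\<And>k. s (c k) < inverse (real (Suc k))" using s(3) by metis
      define u where "u k = e (c k)" for k
      have small: "\<exists>K. \<forall>k\<ge>K. s (c k) < q" if "q > 0" for q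
      proof -
        obtain K where K: "inverse (real (Suc K)) < q" using reals_Archimedean[OF \<open>q > 0\<close>] by blast
        have "s (c k) < q" if "k \<ge> K" for k
        proof -
          have "inverse (real (Suc k)) \<le> inverse (real (Suc K))" using that by (simp add: field_simps)
          then show ?thesis using c[of k] K by linarith
        qed
        then show ?thesis by blast
      qed
      have "MCauchy u" unfolding MCauchy_def
      proof (intro conjI allI impI)
        show "range u \<subseteq> X" using e by (auto simp: u_def)
        fix q :: real assume "q > 0"
        then obtain K where K: "\<forall>k\<ge>K. s (c k) < q / 2" using small[of "q / 2"] by auto
        have "d (u k) (u l) < q" if "K \<le> k" "K \<le> l" for k l
          using K[rule_format, OF that(1)] K[rule_format, OF that(2)] s(1)[of "c k" "c l"] unfolding u_def by linarith
        then show "\<exists>K. \<forall>k l. K \<le> k \<longrightarrow> K \<le> l \<longrightarrow> d (u k) (u l) < q" by blast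
      qed
      then obtain x where x: "limitin mtopology u x sequentially"
        using X(2) unfolding mcomplete_def by blast
      then have xX: "x \<in> X" by (simp add: limitin_metric)
      have "s m = \<iota> x m" for m
      proof (rule ccontr)
        assume "s m \<noteq> \<iota> x m"
        define L where "L = \<bar>s m - \<iota> x m\<bar>"
        have q: "L / 2 > 0" using \<open>s m \<noteq> \<iota> x m\<close> by (simp add: L_def)
        obtain K where K: "\<forall>k\<ge>K. s (c k) < L / 2" using small[OF q] by blast
        have "\<forall>\<^sub>F k in sequentially. u k \<in> X \<and> d (u k) x < L / 2"
          using x q unfolding limitin_metric by blast
        then obtain K' where K': "\<forall>k\<ge>K'. d (u k) x < L / 2"
          unfolding eventually_sequentially by blast
        define k where "k = max K K'"
        have 1: "s (c k) < L / 2" "d (u k) x < L / 2"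
          using K K' by (auto simp: k_def)
        have uX: "u k \<in> X" using e by (simp add: u_def)
        have 2: "d (u k) (e m) \<le> s (c k) + s m" "s m \<le> s (c k) + d (u k) (e m)"
          using s(1)[of "c k" m] s(2)[of m "c k"] by (simp_all add: u_def commute)
        have 3: "d x (e m) \<le> d (u k) x + d (u k) (e m)" "d (u k) (e m) \<le> d (u k) x + d x (e m)"
          using triangle[OF xX uX e, of m] triangle[OF uX xX e, of m] by (simp_all add: commute)
        have "L \<le> s (c k) + d (u k) x"
          using 2 3 unfolding L_def \<iota>_def by linarith
        then show False using 1 by linarith
      qed
      then have "s = \<iota> x" by blast
      then show "s \<in> \<iota> ` X" using xX by blast
    qed
  qed
  have inj: "inj_on \<iota> X"
  proof (rule inj_onI, rule ccontr)
    fix x y assume xy: "x \<in> X" "y \<in> X" "\<iota> x = \<iota> y" "x \<noteq> y"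
    then have "d x y / 2 > 0" by simp
    then obtain n where n: "d x (e n) < d x y / 2" using e_dense[OF xy(1)] by blast
    have "d x (e n) = d y (e n)" using xy(3) by (simp add: \<iota>_def fun_eq_iff)
    then show False using n triangle[OF xy(1) e xy(2), of n] by (simp add: commute)
  qed
  obtain x0 where x0: "x0 \<in> X" using assms(2) space by blast
  define r where "r s = (if s \<in> N then inv_into X \<iota> s else x0)" for s
  have r\<iota>: "r (\<iota> x) = x" if "x \<in> X" for x
    using that image inj by (auto simp: r_def)
  have rX: "r s \<in> X" for s using image inv_into_into[of s \<iota> X] x0 by (auto simp: r_def)
  have "r \<in> borel \<rightarrow>\<^sub>M M"
  proof (rule measurable_sigma_sets[OF T(4)])
    show "{U. openin T U} \<subseteq> Pow (space M)" using T(3) openin_subset by blast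
    show "r \<in> space borel \<rightarrow> space M" using rX by (simp add: space)
    fix U assume "U \<in> {U. openin T U}"
    then have U: "openin mtopology U" using X(3) by simp
    \<comment> \<open>Balls around dense points inside \<open>U\<close>: membership in such a ball
      is a condition on a single coordinate of the code.\<close>
    define Q where "Q = {(n, k). mball (e n) (inverse (real (Suc k))) \<subseteq> U}"
    have "r -` U \<inter> N = N \<inter> (\<Union>(n, k)\<in>Q. {s. s n < inverse (real (Suc k))})"
    proof (intro set_eqI iffI)
      fix s assume s: "s \<in> r -` U \<inter> N"
      then obtain x where x: "x \<in> X" "s = \<iota> x" using image by blast
      then have "x \<in> U" using s r\<iota> by simp
      then obtain q where q: "q > 0" "mball x q \<subseteq> U" using U by (meson openin_mtopology)
      obtain k where k: "inverse (real (Suc k)) < q / 2" using reals_Archimedean[of "q / 2"] q(1) by auto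
      obtain n where n: "d x (e n) < inverse (real (Suc k))" using e_dense[OF x(1)] by (metis inverse_positive_iff_positive of_nat_0_less_iff zero_less_Suc)
      have "mball (e n) (inverse (real (Suc k))) \<subseteq> mball x q"
      proof
        fix z assume "z \<in> mball (e n) (inverse (real (Suc k)))"
        then have z: "z \<in> X" "d (e n) z < inverse (real (Suc k))" by simp_all
        then have "d x z < q" using triangle[OF x(1) e z(1), of n] n k by linarith
        then show "z \<in> mball x q" using x(1) z(1) by simp
      qed
      then have "(n, k) \<in> Q" using q(2) by (auto simp: Q_def)
      then show "s \<in> N \<inter> (\<Union>(n, k)\<in>Q. {s. s n < inverse (real (Suc k))})"
        using s n x(2) by (auto simp: \<iota>_def)
    next
      fix s assume s: "s \<in> N \<inter> (\<Union>(n, k)\<in>Q. {s. s n < inverse (real (Suc k))})"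
      then obtain x where x: "x \<in> X" "s = \<iota> x" using image by blast
      obtain n k where nk: "(n, k) \<in> Q" "s n < inverse (real (Suc k))" using s by blast
      then have "x \<in> mball (e n) (inverse (real (Suc k)))" using x e by (simp add: \<iota>_def commute)
      then have "x \<in> U" using nk(1) by (auto simp: Q_def)
      then show "s \<in> r -` U \<inter> N" using s x r\<iota> by simp
    qed
    moreover have "{s :: nat \<Rightarrow> real. s n < c} \<in> sets borel" for n c
    proof -
      note coord[measurable]
      have "{s \<in> space borel. s n < c} \<in> sets borel" by measurable
      then show ?thesis by simp
    qed
    then have "(\<Union>(n, k)\<in>Q. {s. s n < inverse (real (Suc k))}) \<in> sets borel"
      by (intro sets.countable_UN') auto
    ultimately have rU: "r -` U \<inter> N \<in> sets borel" using N_borel by simp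
    have eq: "r -` U \<inter> space borel = (r -` U \<inter> N) \<union> (if x0 \<in> U then - N else {})"
      by (auto simp: r_def split: if_splits)
    show "r -` U \<inter> space borel \<in> sets borel"
      unfolding eq by (rule sets.Un[OF rU]) (use N_borel in auto)
  qed
  then show thesis using that[of \<iota> r] \<iota>_meas r\<iota> image N_borel by (simp add: space)
qed

text \<open>The graphs \<open>g n\<close> are single-valued only in the forward direction, so adding
  their converses could create infinite degrees. Apart from the diagonal, \<open>G k\<close> instead
  keeps those pairs of \<open>E\<close> for which both directions lie on the first
  \<open>k + 1\<close> graphs; every pair is eventually kept, and the bound on out-degrees survives
  the symmetrisation.\<close>

lemma borel_locally_finite_exhaustion:
  fixes M :: "'a measure"
  assumes E: "countable_borel_equiv M E"
  obtains G :: "nat \<Rightarrow> ('a \<times> 'a) set"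
  where "\<And>k. G k \<in> sets (M \<Otimes>\<^sub>M M)" "\<And>k. G k \<subseteq> G (Suc k)" "(\<Union>k. G k) = E"
    "\<And>k. sym (G k)" "\<And>k x. x \<in> space M \<Longrightarrow> (x, x) \<in> G k" "\<And>k x. finite (G k `` {x})"
proof (cases "space M = {}")
  case True
  have "E \<in> sets (M \<Otimes>\<^sub>M M)" using E by (simp add: countable_borel_equiv_def)
  then have "E = {}" using True sets.sets_into_space by (fastforce simp: space_pair_measure)
  then show thesis using True by (intro that[of "\<lambda>_. {}"]) (auto simp: sym_def)
next
  case ne: False
  have eq: "equiv (space M) E" and Em: "E \<in> sets (M \<Otimes>\<^sub>M M)"
    and cl: "\<And>C. C \<in> space M // E \<Longrightarrow> countable C" and sb: "standard_borel M"
    using E unfolding countable_borel_equiv_def by auto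
  have Esub: "E \<subseteq> space M \<times> space M" using Em sets.sets_into_space by (fastforce simp: space_pair_measure)
  have Erefl: "(x, x) \<in> E" if "x \<in> space M" for x
    using eq that by (simp add: equiv_def refl_on_def)
  have Esym: "(y, x) \<in> E" if "(x, y) \<in> E" for x y
    using eq that by (auto simp: equiv_def sym_def)
  obtain \<iota> :: "'a \<Rightarrow> nat \<Rightarrow> real" and r where \<iota>: "\<iota> \<in> M \<rightarrow>\<^sub>M borel" and r: "r \<in> borel \<rightarrow>\<^sub>M M"
    and r\<iota>: "\<And>x. x \<in> space M \<Longrightarrow> r (\<iota> x) = x" and N: "\<iota> ` space M \<in> sets borel"
    using standard_borel_retract[OF sb ne] by metis
  have rsp: "r s \<in> space M" for s using measurable_space[OF r, of s] by simp
  \<comment> \<open>Restricting to codes keeps the sections countable, since a code is determined by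
    the point it stands for.\<close>
  define P where "P = (\<lambda>p. (r (fst p), r (snd p))) -` E \<inter> (\<iota> ` space M) \<times> (\<iota> ` space M)"
  have "(\<lambda>p. (r (fst p), r (snd p))) \<in> borel \<Otimes>\<^sub>M borel \<rightarrow>\<^sub>M M \<Otimes>\<^sub>M M"
    by (intro measurable_Pair measurable_compose[OF measurable_fst r] measurable_compose[OF measurable_snd r])
  from measurable_sets[OF this Em]
  have "(\<lambda>p. (r (fst p), r (snd p))) -` E \<in> sets (borel \<Otimes>\<^sub>M borel)"
    by (simp add: space_pair_measure)
  then have P: "P \<in> sets (borel \<Otimes>\<^sub>M borel)"
    unfolding P_def using N by (intro sets.Int pair_measureI)
  have sec: "countable {b. (a, b) \<in> P}" for a
  proof -
    have "E `` {r a} \<in> space M // E" using rsp by (rule quotientI)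
    then have "countable (\<iota> ` (E `` {r a}))" using cl by (intro countable_image)
    moreover have "{b. (a, b) \<in> P} \<subseteq> \<iota> ` (E `` {r a})"
    proof
      fix b assume "b \<in> {b. (a, b) \<in> P}"
      then have "(r a, r b) \<in> E" "b \<in> \<iota> ` space M" by (auto simp: P_def)
      moreover have "b = \<iota> (r b)" using \<open>b \<in> \<iota> ` space M\<close> r\<iota> by auto
      ultimately show "b \<in> \<iota> ` (E `` {r a})" by blast
    qed
    ultimately show ?thesis using countable_subset by blast
  qed
  obtain g where g: "\<And>n::nat. g n \<in> sets (borel \<Otimes>\<^sub>M borel)" "\<And>n. single_valued (g n)" "P \<subseteq> (\<Union>n. g n)"
    using lusin_novikov[OF P sec] by metis
  define A where "A k = (\<lambda>p. (\<iota> (fst p), \<iota> (snd p))) -` (\<Union>n\<le>k. g n)" for k :: nat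
  define G where "G k = E \<inter> ({p. \<iota> (fst p) = \<iota> (snd p)} \<union> A k \<inter> prod.swap -` A k)" for k
  have cover: "\<exists>n. (\<iota> x, \<iota> y) \<in> g n" if "(x, y) \<in> E" for x y
  proof -
    have "x \<in> space M" "y \<in> space M" using that Esub by auto
    then have "(\<iota> x, \<iota> y) \<in> P" using that r\<iota> by (simp add: P_def)
    then show ?thesis using g(3) by blast
  qed
  show thesis
  proof (rule that[of G])
    fix k
    have m1: "(\<lambda>p. (\<iota> (fst p), \<iota> (snd p))) \<in> M \<Otimes>\<^sub>M M \<rightarrow>\<^sub>M borel \<Otimes>\<^sub>M borel"
      by (intro measurable_Pair measurable_compose[OF measurable_fst \<iota>] measurable_compose[OF measurable_snd \<iota>])
    have m2: "(\<lambda>p. (\<iota> (snd p), \<iota> (fst p))) \<in> M \<Otimes>\<^sub>M M \<rightarrow>\<^sub>M borel \<Otimes>\<^sub>M borel"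
      by (intro measurable_Pair measurable_compose[OF measurable_fst \<iota>] measurable_compose[OF measurable_snd \<iota>])
    have gk: "(\<Union>n\<le>k. g n) \<in> sets (borel \<Otimes>\<^sub>M borel)" using g(1) by (intro sets.finite_UN) auto
    have diag: "{s. fst s = snd s} \<in> sets (borel \<Otimes>\<^sub>M borel :: ((nat \<Rightarrow> real) \<times> (nat \<Rightarrow> real)) measure)"
      unfolding borel_prod by (intro borel_closed closed_Collect_eq continuous_intros)
    have "G k = E \<inter> ((\<lambda>p. (\<iota> (fst p), \<iota> (snd p))) -` {s. fst s = snd s} \<inter> space (M \<Otimes>\<^sub>M M) \<union>
       (\<lambda>p. (\<iota> (fst p), \<iota> (snd p))) -` (\<Union>n\<le>k. g n) \<inter> space (M \<Otimes>\<^sub>M M) \<inter>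
       ((\<lambda>p. (\<iota> (snd p), \<iota> (fst p))) -` (\<Union>n\<le>k. g n) \<inter> space (M \<Otimes>\<^sub>M M)))"
      using sets.sets_into_space[OF Em] by (auto simp: G_def A_def)
    also have "\<dots> \<in> sets (M \<Otimes>\<^sub>M M)"
      by (intro sets.Int sets.Un Em measurable_sets[OF m1] measurable_sets[OF m2] diag gk)
    finally show "G k \<in> sets (M \<Otimes>\<^sub>M M)" .
    have "A k \<subseteq> A (Suc k)" unfolding A_def by (intro vimage_mono UN_mono) auto
    then show "G k \<subseteq> G (Suc k)" unfolding G_def by auto
    show "sym (G k)"
      by (rule symI) (auto simp: G_def dest: Esym)
    show "(x, x) \<in> G k" if "x \<in> space M" for x using that Erefl by (simp add: G_def)
    show "finite (G k `` {x})" for x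
    proof -
      have inj: "y = z" if "(x, y) \<in> E" "(x, z) \<in> E" "\<iota> y = \<iota> z" for y z
        using r\<iota>[of y] r\<iota>[of z] that Esub by auto
      have fin: "finite {y. (x, y) \<in> E \<and> (\<iota> x, \<iota> y) \<in> g n}" for n
      proof (rule finite_subset)
        show "{y. (x, y) \<in> E \<and> (\<iota> x, \<iota> y) \<in> g n} \<subseteq> {THE y. (x, y) \<in> E \<and> (\<iota> x, \<iota> y) \<in> g n}"
        proof
          fix y assume y: "y \<in> {y. (x, y) \<in> E \<and> (\<iota> x, \<iota> y) \<in> g n}"
          have "(THE y. (x, y) \<in> E \<and> (\<iota> x, \<iota> y) \<in> g n) = y"
          proof (rule the_equality)
            show "z = y" if "(x, z) \<in> E \<and> (\<iota> x, \<iota> z) \<in> g n" for z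
              using that y inj single_valuedD[OF g(2)] by blast
          qed (use y in simp)
          then show "y \<in> {THE y. (x, y) \<in> E \<and> (\<iota> x, \<iota> y) \<in> g n}" by simp
        qed
      qed simp
      have "G k `` {x} \<subseteq> {x} \<union> (\<Union>n\<le>k. {y. (x, y) \<in> E \<and> (\<iota> x, \<iota> y) \<in> g n})"
      proof
        fix y assume "y \<in> G k `` {x}"
        then have "(x, y) \<in> G k" by simp
        then have y: "(x, y) \<in> E" "\<iota> x = \<iota> y \<or> (\<exists>n\<le>k. (\<iota> x, \<iota> y) \<in> g n)" by (auto simp: G_def A_def)
        have "(x, x) \<in> E" using y(1) Esub Erefl by auto
        then have "x = y" if "\<iota> x = \<iota> y" using inj that y(1) by blast
        then show "y \<in> {x} \<union> (\<Union>n\<le>k. {y. (x, y) \<in> E \<and> (\<iota> x, \<iota> y) \<in> g n})" using y by auto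
      qed
      then show ?thesis by (rule finite_subset) (use fin in auto)
    qed
  next
    show "(\<Union>k. G k) = E"
    proof
      show "(\<Union>k. G k) \<subseteq> E" by (auto simp: G_def)
      show "E \<subseteq> (\<Union>k. G k)"
      proof
        fix p assume "p \<in> E"
        then obtain x y where xy: "p = (x, y)" "(x, y) \<in> E" by (cases p) simp
        obtain n1 where n1: "(\<iota> x, \<iota> y) \<in> g n1" using cover xy(2) by blast
        obtain n2 where n2: "(\<iota> y, \<iota> x) \<in> g n2" using cover[OF Esym[OF xy(2)]] by blast
        have "p \<in> A (max n1 n2)" "prod.swap p \<in> A (max n1 n2)"
          using n1 n2 by (auto simp: A_def xy(1) intro: exI[of _ n1] exI[of _ n2])
        then have "p \<in> G (max n1 n2)" using \<open>p \<in> E\<close> by (simp add: G_def)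
        then show "p \<in> (\<Union>k. G k)" by blast
      qed
    qed
  qed
qed

section \<open>Contractibility of telescopes\<close>

lemma closed_simplex_realization: "closed (simplex_realization s :: ('v \<Rightarrow> real) set)"
proof -
  have c: "continuous_on UNIV (\<lambda>a :: 'v \<Rightarrow> real. a x)" for x
    by (rule continuous_on_product_then_coordinatewise, rule continuous_on_id)
  have "simplex_realization s = (\<Inter>x. {a. 0 \<le> a x} \<inter> {a. a x \<le> 1}) \<inter> (\<Inter>x\<in>- s. {a. a x = 0}) \<inter>
      {a. (\<Sum>x\<in>s. a x) = 1}"
    by (auto simp: simplex_realization_def)
  moreover have "closed \<dots>"
    by (intro closed_Int closed_INT ballI closed_Collect_le closed_Collect_eq c continuous_on_const continuous_on_sum)
  ultimately show ?thesis by simp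
qed

lemma simplex_realization_convex:
  assumes "a \<in> simplex_realization s" "b \<in> simplex_realization s" "t \<in> {0..1}"
  shows "(\<lambda>x. (1 - t) * a x + t * b x) \<in> simplex_realization s"
proof -
  have "(\<Sum>x\<in>s. (1 - t) * a x + t * b x) = (1 - t) * (\<Sum>x\<in>s. a x) + t * (\<Sum>x\<in>s. b x)"
    by (simp add: sum.distrib sum_distrib_left)
  moreover have "(1 - t) * a x + t * b x \<le> 1" "0 \<le> (1 - t) * a x + t * b x" for x
  proof -
    have ab: "0 \<le> a x" "a x \<le> 1" "0 \<le> b x" "b x \<le> 1" using assms by (auto simp: simplex_realization_def)
    then have "(1 - t) * a x \<le> 1 - t" "t * b x \<le> t" using assms(3) by (auto simp: mult_left_le)
    then show "(1 - t) * a x + t * b x \<le> 1" by linarith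
    show "0 \<le> (1 - t) * a x + t * b x" using ab assms(3) by simp
  qed
  ultimately show ?thesis using assms by (auto simp: simplex_realization_def)
qed

lemma simplex_realization_support:
  assumes "a \<in> simplex_realization s" "finite s"
  shows "{x. a x \<noteq> 0} \<subseteq> s" "(\<Sum>x | a x \<noteq> 0. a x) = 1"
proof -
  show sub: "{x. a x \<noteq> 0} \<subseteq> s" using assms by (auto simp: simplex_realization_def)
  have "(\<Sum>x\<in>s. a x) = (\<Sum>x | a x \<noteq> 0. a x)"
    using sub assms(2) by (intro sum.mono_neutral_right) auto
  then show "(\<Sum>x | a x \<noteq> 0. a x) = 1" using assms(1) by (simp add: simplex_realization_def)
qed

text \<open>
  An open star meets only finitely many simplices, each of which is closed in the product topology;
  hence the weak topology is the product topology.
\<close>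

lemma realization_locally_finite:
  fixes S :: "'v set set"
  assumes fin: "\<And>s. s \<in> S \<Longrightarrow> finite s"
    and lf: "\<And>v. finite (B v)" "\<And>s v. s \<in> S \<Longrightarrow> v \<in> s \<Longrightarrow> s \<subseteq> B v"
  shows "realization S = top_of_set (\<Union>s\<in>S. simplex_realization s)"
  unfolding topology_eq
proof (intro allI iffI)
  let ?R = "\<Union>s\<in>S. simplex_realization s"
  fix U assume U: "openin (realization S) U"
  have UR: "U \<subseteq> ?R" and Us: "\<And>s. s \<in> S \<Longrightarrow> openin (top_of_set (simplex_realization s)) (U \<inter> simplex_realization s)"
    using U unfolding openin_realization by auto
  show "openin (top_of_set ?R) U"
  proof (subst openin_subopen, intro ballI)
    fix a assume "a \<in> U"
    then obtain s0 where s0: "s0 \<in> S" "a \<in> simplex_realization s0" using UR by blast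
    have "\<exists>v\<in>s0. a v \<noteq> 0"
    proof (rule ccontr)
      assume "\<not> ?thesis"
      then have "(\<Sum>x\<in>s0. a x) = 0" by (intro sum.neutral) auto
      then show False using s0 by (simp add: simplex_realization_def)
    qed
    then obtain v where v: "v \<in> s0" "a v > 0"
      using s0(2) by (force simp: simplex_realization_def order.order_iff_strict)
    \<comment> \<open>What must be avoided inside the open star of \<open>v\<close>: finitely many
      closed sets.\<close>
    define Z where "Z = (\<Union>s\<in>{s \<in> S. s \<subseteq> B v}. simplex_realization s - U)"
    have "closed (simplex_realization s - U)" if "s \<in> S" for s
    proof -
      have "closedin (top_of_set (simplex_realization s)) (simplex_realization s - (U \<inter> simplex_realization s))"
        using Us[OF that] closedin_diff closedin_topspace topspace_euclidean_subtopology
        by (metis closedin_subtopology_refl topspace_euclidean UNIV_I subset_UNIV)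
      then have "closed (simplex_realization s - (U \<inter> simplex_realization s))"
        using closed_simplex_realization closedin_closed_trans by blast
      moreover have "simplex_realization s - (U \<inter> simplex_realization s) = simplex_realization s - U" by blast
      ultimately show ?thesis by simp
    qed
    moreover have "finite {s \<in> S. s \<subseteq> B v}" by (rule finite_subset[of _ "Pow (B v)"]) (use lf(1) in auto)
    ultimately have Zc: "closed Z" unfolding Z_def by (intro closed_UN) auto
    have "open {b :: 'v \<Rightarrow> real. 0 < b v}"
      by (intro open_Collect_less continuous_on_const)
        (rule continuous_on_product_then_coordinatewise, rule continuous_on_id)
    then have o: "open ({b. 0 < b v} \<inter> - Z)" using Zc by auto
    show "\<exists>T. openin (top_of_set ?R) T \<and> a \<in> T \<and> T \<subseteq> U"
    proof (intro exI conjI)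
      show "openin (top_of_set ?R) (?R \<inter> ({b. 0 < b v} \<inter> - Z))" using o by (rule openin_open_Int)
      show "a \<in> ?R \<inter> ({b. 0 < b v} \<inter> - Z)" using v(2) s0 \<open>a \<in> U\<close> by (auto simp: Z_def)
      show "?R \<inter> ({b. 0 < b v} \<inter> - Z) \<subseteq> U"
      proof
        fix b assume b: "b \<in> ?R \<inter> ({b. 0 < b v} \<inter> - Z)"
        then obtain s where s: "s \<in> S" "b \<in> simplex_realization s" by blast
        have "v \<in> s" using b s(2) by (auto simp: simplex_realization_def)
        then have "s \<subseteq> B v" using lf(2) s(1) by blast
        then show "b \<in> U" using b s by (auto simp: Z_def)
      qed
    qed
  qed
next
  let ?R = "\<Union>s\<in>S. simplex_realization s"
  fix U assume "openin (top_of_set ?R) U"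
  then obtain W where W: "open W" "U = ?R \<inter> W" by (auto simp: openin_open)
  have "openin (top_of_set (simplex_realization s)) (U \<inter> simplex_realization s)" if "s \<in> S" for s
  proof -
    have "U \<inter> simplex_realization s = simplex_realization s \<inter> W" using W(2) that by blast
    then show ?thesis using W(1) openin_open_Int by metis
  qed
  then show "openin (realization S) U" unfolding openin_realization using W(2) by blast
qed

section \<open>Mapping telescopes and their contraction\<close>

lemma homotopic_with_canonI:
  fixes h :: "real \<times> 'a::topological_space \<Rightarrow> 'b::topological_space"
  assumes "continuous_on ({0..1} \<times> X) h" "\<And>t x. t \<in> {0..1} \<Longrightarrow> x \<in> X \<Longrightarrow> h (t, x) \<in> Y"
    and "\<And>x. x \<in> X \<Longrightarrow> h (0, x) = f x" "\<And>x. x \<in> X \<Longrightarrow> h (1, x) = g x"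
  shows "homotopic_with_canon (\<lambda>_. True) X Y f g"
proof (subst homotopic_with)
  show "\<exists>h. continuous_map (prod_topology (top_of_set {0..1::real}) (top_of_set X)) (top_of_set Y) h \<and>
        (\<forall>x\<in>topspace (top_of_set X). h (0, x) = f x) \<and>
        (\<forall>x\<in>topspace (top_of_set X). h (1, x) = g x) \<and> (\<forall>t\<in>{0..1::real}. True)"
    using assms by (intro exI[of _ h]) auto
qed simp

text \<open>The integer translates of this tent form a partition of unity, so the numbers
  \<open>hat (r - real k)\<close> are the barycentric coordinates of a real height
  \<open>r \<ge> 0\<close> among the integer levels \<open>k\<close>.\<close>

definition hat :: "real \<Rightarrow> real" where "hat r = max 0 (1 - \<bar>r\<bar>)"

text \<open>
  The mapping telescope of the clique complexes of the graphs \<open>G k\<close>: the vertex \<open>v\<close> stands for the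
  point \<open>p v\<close> at level \<open>l v\<close>. Full simplices on \<open>Q \<times> {k, k + 1}\<close> replace triangulated prisms.
\<close>

definition telescope :: "'v set \<Rightarrow> ('v \<Rightarrow> 'a) \<Rightarrow> ('v \<Rightarrow> nat) \<Rightarrow> (nat \<Rightarrow> ('a \<times> 'a) set) \<Rightarrow> 'v set set" where
  "telescope V p l G = {s. finite s \<and> s \<noteq> {} \<and> s \<subseteq> V \<and>
     (\<exists>k. \<forall>u\<in>s. l u \<in> {k, Suc k} \<and> (\<forall>v\<in>s. (p u, p v) \<in> G k))}"

text \<open>Masses \<open>q i\<close> sit over \<open>X i\<close> at the real levels \<open>r i\<close>, which \<open>hat\<close> splits between adjacent levels.\<close>

lemma blend_in_simplex_realization:
  fixes c :: "'a \<Rightarrow> nat \<Rightarrow> 'v" and V :: "'v set"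
  assumes c: "\<And>x k. x \<in> C \<Longrightarrow> c x k \<in> V \<and> p (c x k) = x \<and> l (c x k) = k"
    and V: "\<And>v. v \<in> V \<Longrightarrow> p v \<in> C \<and> c (p v) (l v) = v"
    and I: "finite I" "\<And>i. i \<in> I \<Longrightarrow> 0 \<le> q i" "(\<Sum>i\<in>I. q i) = 1"
    and X: "\<And>i. i \<in> I \<Longrightarrow> X i \<in> C"
    and r: "\<And>i. i \<in> I \<Longrightarrow> real n \<le> r i \<and> r i \<le> real n + 1"
    and Q: "X ` I \<subseteq> Q" "finite Q" "Q \<subseteq> C"
  shows "(\<lambda>u. if u \<in> V then \<Sum>i\<in>I. q i * (if X i = p u then hat (r i - real (l u)) else 0) else 0)
     \<in> simplex_realization ((\<lambda>(x, k). c x k) ` (Q \<times> {n, Suc n}))" (is "?b \<in> simplex_realization ?s")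
proof -
  have hat0: "0 \<le> hat y" for y by (simp add: hat_def)
  have nonneg: "0 \<le> ?b u" for u using I(2) hat0 by (auto intro!: sum_nonneg)
  have fin: "finite ?s" using Q(2) by simp
  have zero: "?b u = 0" if "u \<notin> ?s" for u
  proof (cases "u \<in> V")
    case True
    have "(if X i = p u then hat (r i - real (l u)) else 0) = 0" if i: "i \<in> I" for i
    proof (cases "X i = p u")
      case True
      then have "p u \<in> Q" using Q(1) i by auto
      then have "l u \<noteq> n" "l u \<noteq> Suc n" using \<open>u \<notin> ?s\<close> V[OF \<open>u \<in> V\<close>] by force+
      then have "real (l u) + 1 \<le> real n \<or> real n + 2 \<le> real (l u)" by linarith
      then have "hat (r i - real (l u)) = 0" using r[OF i] by (auto simp: hat_def)
      then show ?thesis by simp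
    qed simp
    then show ?thesis using True by simp
  qed simp
  have inj: "inj_on (\<lambda>(x, k). c x k) (Q \<times> {n, Suc n})"
  proof (rule inj_onI, clarify)
    fix x k x' k' assume "x \<in> Q" "x' \<in> Q" "c x k = c x' k'"
    then show "x = x' \<and> k = k'" using c[of x k] c[of x' k'] Q(3) by auto
  qed
  have "(\<Sum>u\<in>?s. ?b u) = (\<Sum>(x, k)\<in>Q \<times> {n, Suc n}. ?b (c x k))"
    using inj by (subst sum.reindex) (auto simp: case_prod_unfold)
  also have "\<dots> = (\<Sum>x\<in>Q. \<Sum>k\<in>{n, Suc n}. ?b (c x k))"
    by (rule sum.cartesian_product[symmetric])
  also have "\<dots> = (\<Sum>x\<in>Q. \<Sum>k\<in>{n, Suc n}. \<Sum>i\<in>I. q i * (if X i = x then hat (r i - real k) else 0))"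
  proof (intro sum.cong refl)
    fix x k assume "x \<in> Q"
    then have "x \<in> C" using Q(3) by blast
    then show "?b (c x k) = (\<Sum>i\<in>I. q i * (if X i = x then hat (r i - real k) else 0))"
      using c[of x k] by (simp cong: if_cong)
  qed
  also have "\<dots> = (\<Sum>x\<in>Q. \<Sum>i\<in>I. if X i = x then q i else 0)"
  proof (rule sum.cong[OF refl])
    fix x
    have "(\<Sum>k\<in>{n, Suc n}. \<Sum>i\<in>I. q i * (if X i = x then hat (r i - real k) else 0)) =
        (\<Sum>i\<in>I. q i * (if X i = x then hat (r i - real n) + hat (r i - real (Suc n)) else 0))"
      by (simp add: sum.distrib[symmetric]) (rule sum.cong, auto simp: algebra_simps)
    also have "\<dots> = (\<Sum>i\<in>I. if X i = x then q i else 0)"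
    proof (rule sum.cong[OF refl])
      fix i assume i: "i \<in> I"
      \<comment> \<open>Between \<open>n\<close> and \<open>n + 1\<close> these two tents add up to
        1, so the splitting preserves mass.\<close>
      have "hat (r i - real n) + hat (r i - real (Suc n)) = 1" using r[OF i] by (simp add: hat_def)
      then show "q i * (if X i = x then hat (r i - real n) + hat (r i - real (Suc n)) else 0) = (if X i = x then q i else 0)"
        by (cases "X i = x") (simp_all only: if_True if_False mult_1_right mult_zero_right simp_thms)
    qed
    finally show "(\<Sum>k\<in>{n, Suc n}. \<Sum>i\<in>I. q i * (if X i = x then hat (r i - real k) else 0)) =
       (\<Sum>i\<in>I. if X i = x then q i else 0)" .
  qed
  also have "\<dots> = (\<Sum>i\<in>I. \<Sum>x\<in>Q. if X i = x then q i else 0)" by (rule sum.swap)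
  also have "\<dots> = (\<Sum>i\<in>I. q i)" using Q by (intro sum.cong refl) (auto simp: sum.delta')
  finally have sum1: "(\<Sum>u\<in>?s. ?b u) = 1" using I(3) by simp
  have "?b u \<le> 1" for u
  proof (cases "u \<in> ?s")
    case True
    then have "?b u \<le> (\<Sum>u\<in>?s. ?b u)" using nonneg fin by (intro member_le_sum) auto
    then show ?thesis using sum1 by simp
  next
    case False
    then show ?thesis using zero[OF False] by simp
  qed
  then show ?thesis unfolding simplex_realization_def using nonneg zero sum1 by simp
qed

text \<open>All stages of the contraction take place in such prisms over a finite clique
  \<open>Q\<close>.\<close>

lemma telescopeI_prism:
  assumes c: "\<And>x k. x \<in> C \<Longrightarrow> c x k \<in> V \<and> p (c x k) = x \<and> l (c x k) = k"
    and Q: "finite Q" "Q \<noteq> {}" "Q \<subseteq> C" "Q \<times> Q \<subseteq> G n"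
  shows "(\<lambda>(x, k). c x k) ` (Q \<times> {n, Suc n}) \<in> telescope V p l G"
  unfolding telescope_def
proof (intro CollectI conjI exI[of _ n] ballI)
  show "(\<lambda>(x, k). c x k) ` (Q \<times> {n, Suc n}) \<subseteq> V" using c Q(3) by auto
  fix u assume "u \<in> (\<lambda>(x, k). c x k) ` (Q \<times> {n, Suc n})"
  then have u: "l u \<in> {n, Suc n}" "p u \<in> Q" using c Q(3) by auto
  then show "l u \<in> {n, Suc n}" by simp
  fix v assume "v \<in> (\<lambda>(x, k). c x k) ` (Q \<times> {n, Suc n})"
  then have "p v \<in> Q" using c Q(3) by auto
  then show "(p u, p v) \<in> G n" using u(2) Q(4) by auto
qed (use Q in auto)

lemma continuous_on_hat: "continuous_on A f \<Longrightarrow> continuous_on A (\<lambda>x. hat (f x))"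
  unfolding hat_def by (intro continuous_intros)

text \<open>The maps \<open>c\<close>, \<open>p\<close>, \<open>l\<close> identify \<open>V\<close>
  with pairs from \<open>C\<close> and the naturals without fixing a type of vertices, since the
  final vertices are reals coding such pairs. The base point \<open>x0\<close> is arbitrary and
  enters no measurability statement.\<close>

lemma contractible_telescope:
  fixes c :: "'a \<Rightarrow> nat \<Rightarrow> 'v" and V :: "'v set"
  assumes c: "\<And>x k. x \<in> C \<Longrightarrow> c x k \<in> V \<and> p (c x k) = x \<and> l (c x k) = k"
    and V: "\<And>v. v \<in> V \<Longrightarrow> p v \<in> C \<and> c (p v) (l v) = v"
    and G_mono: "\<And>k. G k \<subseteq> G (Suc k)" and G_sym: "\<And>k. sym (G k)"
    and G_refl: "\<And>k x. x \<in> C \<Longrightarrow> (x, x) \<in> G k"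
    and G_fin: "\<And>k x. finite (G k `` {x})" and G_cover: "\<And>x y. x \<in> C \<Longrightarrow> y \<in> C \<Longrightarrow> \<exists>k. (x, y) \<in> G k"
    and x0: "x0 \<in> C"
  shows "locally_finite_complex V (telescope V p l G)" "contractible_complex (telescope V p l G)"
proof -
  let ?S = "telescope V p l G"
  have G_le: "G j \<subseteq> G k" if "j \<le> k" for j k
    by (rule lift_Suc_mono_le[of G, OF G_mono that])
  \<comment> \<open>A simplex through \<open>v\<close> lying over levels \<open>k\<close> and
    \<open>k + 1\<close> has \<open>k \<le> l v\<close>, so its edges already belong to
    \<open>G (l v)\<close> and its levels do not exceed \<open>l v + 1\<close>.\<close>
  define B where "B v = (\<lambda>(x, k). c x k) ` (G (l v) `` {p v} \<times> {..Suc (l v)})" for v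
  have B_fin: "finite (B v)" for v unfolding B_def using G_fin by (intro finite_imageI finite_cartesian_product) auto
  have S_B: "s \<subseteq> B v" if "s \<in> ?S" "v \<in> s" for s v
  proof
    fix u assume "u \<in> s"
    obtain k where k: "\<forall>u\<in>s. l u \<in> {k, Suc k} \<and> (\<forall>v\<in>s. (p u, p v) \<in> G k)" and sV: "s \<subseteq> V"
      using \<open>s \<in> ?S\<close> unfolding telescope_def by blast
    have "l u \<in> {k, Suc k}" "l v \<in> {k, Suc k}" using k \<open>u \<in> s\<close> that(2) by blast+
    then have "k \<le> l v" "l u \<le> Suc (l v)" by auto
    moreover have "(p v, p u) \<in> G (l v)" using k \<open>u \<in> s\<close> that(2) G_le[OF \<open>k \<le> l v\<close>] by blast
    moreover have "u = c (p u) (l u)" using V sV \<open>u \<in> s\<close> by force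
    ultimately show "u \<in> B v" unfolding B_def by (intro image_eqI[of _ _ "(p u, l u)"]) auto
  qed
  have fin: "finite s" if "s \<in> ?S" for s using that by (simp add: telescope_def)
  show "locally_finite_complex V ?S"
    unfolding locally_finite_complex_def
  proof
    fix v
    have "{e \<in> edges ?S. v \<in> e} \<subseteq> Pow (B v)" using S_B by (auto simp: edges_def)
    then show "finite {e \<in> edges ?S. v \<in> e}" by (rule finite_subset) (use B_fin in auto)
  qed
  define R where "R = (\<Union>s\<in>?S. simplex_realization s)"
  have real_eq: "realization ?S = top_of_set R"
    unfolding R_def using fin B_fin S_B by (rule realization_locally_finite)
  define supp where "supp a = {v. a v \<noteq> 0}" for a :: "'v \<Rightarrow> real"
  have supp: "\<exists>s\<in>?S. supp a \<subseteq> s \<and> a \<in> simplex_realization s" "finite (supp a)" "(\<Sum>v\<in>supp a. a v) = 1" 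
    "supp a \<subseteq> V" "\<And>v. 0 \<le> a v" if "a \<in> R" for a
  proof -
    obtain s where s: "s \<in> ?S" "a \<in> simplex_realization s" using \<open>a \<in> R\<close> by (auto simp: R_def)
    note * = simplex_realization_support[OF s(2) fin[OF s(1)]]
    show "\<exists>s\<in>?S. supp a \<subseteq> s \<and> a \<in> simplex_realization s" using s * by (auto simp: supp_def)
    show "finite (supp a)" using finite_subset[OF *(1) fin[OF s(1)]] by (simp add: supp_def)
    show "(\<Sum>v\<in>supp a. a v) = 1" using *(2) by (simp add: supp_def)
    show "supp a \<subseteq> V" using *(1) s(1) by (auto simp: supp_def telescope_def)
    show "0 \<le> a v" for v using s(2) by (auto simp: simplex_realization_def)
  qed
  have supp_level: "\<exists>k. \<forall>u\<in>supp a. l u \<in> {k, Suc k} \<and> (\<forall>v\<in>supp a. (p u, p v) \<in> G k)" if "a \<in> R" for a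
  proof -
    obtain s where s: "s \<in> ?S" "supp a \<subseteq> s" using supp(1)[OF \<open>a \<in> R\<close>] by blast
    then obtain k where "\<forall>u\<in>s. l u \<in> {k, Suc k} \<and> (\<forall>v\<in>s. (p u, p v) \<in> G k)"
      unfolding telescope_def by blast
    then show ?thesis using s(2) by blast
  qed
  have supp_B: "supp a \<subseteq> B v" if "a \<in> R" "a v \<noteq> 0" for a v
    using supp(1)[OF that(1)] S_B that(2) by (fastforce simp: supp_def)

  \<comment> \<open>\<open>m\<close> is continuous, and as a weighted mean of values \<open>M v\<close> it is at least one of them: at level
    \<open>m a\<close> the support of \<open>a\<close> spans a simplex together with \<open>x0\<close>\<close>
  have "\<exists>k>l v. \<forall>u\<in>B v \<inter> V. (p u, x0) \<in> G k" for v
  proof -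
    have "\<forall>u\<in>B v \<inter> V. \<exists>k. (p u, x0) \<in> G k" using G_cover V x0 by blast
    then obtain h where h: "\<And>u. u \<in> B v \<inter> V \<Longrightarrow> (p u, x0) \<in> G (h u)" by metis
    define k where "k = Max (insert (Suc (l v)) (h ` (B v \<inter> V)))"
    have k: "Suc (l v) \<le> k" "\<And>u. u \<in> B v \<inter> V \<Longrightarrow> h u \<le> k"
      unfolding k_def using B_fin by (auto intro!: Max_ge)
    have "(p u, x0) \<in> G k" if "u \<in> B v \<inter> V" for u
      using h[OF that] G_le[OF k(2)[OF that]] by blast
    then show ?thesis using k(1) Suc_le_lessD by blast
  qed
  then obtain M where M: "\<And>v. l v < M v" "\<And>v u. u \<in> B v \<Longrightarrow> u \<in> V \<Longrightarrow> (p u, x0) \<in> G (M v)"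
    by (metis IntI)
  define m where "m a = (\<Sum>v\<in>supp a. a v * real (M v))" for a
  \<comment> \<open>Mass at \<open>v\<close> is raised to height \<open>max (real (l v)) t\<close>
    and never lowered, so \<open>push 0\<close> is the identity on \<open>R\<close>, and mass stays
    over the same point of \<open>C\<close>.\<close>
  define push where "push t a = (\<lambda>u. if u \<in> V then \<Sum>v\<in>supp a. a v *
     (if p v = p u then hat (max (real (l v)) t - real (l u)) else 0) else 0)" for t a
  define delta where "delta t = (\<lambda>u. if u \<in> V then if x0 = p u then hat (t - real (l u)) else 0 else 0)" for t :: real

  \<comment> \<open>Levels \<open>k\<close> and \<open>k + 1\<close>, raised to height at least
    \<open>t\<close>, still fit between \<open>n\<close> and \<open>n + 1\<close>.\<close>
  have push_in: "push t a \<in> simplex_realization ((\<lambda>(x, k). c x k) ` (Q \<times> {n, Suc n}))"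
    if a: "a \<in> R" and k: "\<forall>u\<in>supp a. l u \<in> {k, Suc k}" and n: "n = max k (nat \<lfloor>t\<rfloor>)"
      and Q: "p ` supp a \<subseteq> Q" "finite Q" "Q \<subseteq> C" for t a k n Q
    unfolding push_def
  proof (rule blend_in_simplex_realization[OF c V])
    show "finite (supp a)" "(\<Sum>i\<in>supp a. a i) = 1" using supp[OF a] by auto
    show "0 \<le> a i" for i using supp(5)[OF a] .
    show "p i \<in> C" if "i \<in> supp a" for i using that supp(4)[OF a] V by auto
    show "real n \<le> max (real (l i)) t \<and> max (real (l i)) t \<le> real n + 1" if "i \<in> supp a" for i
    proof -
      have "l i = k \<or> l i = Suc k" using k that by auto
      then show ?thesis unfolding n by (auto simp: max_def) linarith+
    qed
  qed (use Q in auto)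
  have delta_in: "delta t \<in> simplex_realization ((\<lambda>(x, k). c x k) ` (Q \<times> {n, Suc n}))"
    if "n = nat \<lfloor>t\<rfloor>" "0 \<le> t" "x0 \<in> Q" "finite Q" "Q \<subseteq> C" for t n Q
  proof -
    have "(\<lambda>u. if u \<in> V then \<Sum>i\<in>{()}. 1 * (if x0 = p u then hat (t - real (l u)) else 0) else 0)
      \<in> simplex_realization ((\<lambda>(x, k). c x k) ` (Q \<times> {n, Suc n}))"
    proof (rule blend_in_simplex_realization[OF c V])
      show "real n \<le> t \<and> t \<le> real n + 1" using that by linarith
    qed (use that x0 in auto)
    then show ?thesis by (simp add: delta_def cong: if_cong)
  qed
  have push_R: "push t a \<in> R" if a: "a \<in> R" for t a
  proof -
    obtain k where k: "\<forall>u\<in>supp a. l u \<in> {k, Suc k} \<and> (\<forall>v\<in>supp a. (p u, p v) \<in> G k)"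
      using supp_level[OF a] by blast
    define n where "n = max k (nat \<lfloor>t\<rfloor>)"
    have ne: "p ` supp a \<noteq> {}" using supp(3)[OF a] by auto
    have fC: "finite (p ` supp a)" "p ` supp a \<subseteq> C" using supp(2,4)[OF a] V by auto
    have "p ` supp a \<times> p ` supp a \<subseteq> G n" using k G_le[of k n] by (auto simp: n_def)
    then have "(\<lambda>(x, k). c x k) ` (p ` supp a \<times> {n, Suc n}) \<in> ?S"
      using ne fC by (intro telescopeI_prism[OF c]) auto
    moreover have "push t a \<in> simplex_realization ((\<lambda>(x, k). c x k) ` (p ` supp a \<times> {n, Suc n}))"
      using k fC n_def by (intro push_in[OF a]) auto
    ultimately show ?thesis unfolding R_def by blast
  qed
  have delta_R: "delta t \<in> R" if "0 \<le> t" for t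
  proof -
    have "(\<lambda>(x, k). c x k) ` ({x0} \<times> {nat \<lfloor>t\<rfloor>, Suc (nat \<lfloor>t\<rfloor>)}) \<in> ?S"
      using x0 G_refl by (intro telescopeI_prism[OF c]) auto
    then show ?thesis using delta_in[OF refl that, of "{x0}"] x0 unfolding R_def by auto
  qed
  have m_bound: "\<exists>v\<in>supp a. real (M v) \<le> m a" if a: "a \<in> R" for a
  proof (rule ccontr)
    assume "\<not> ?thesis"
    then have "m a < real (M v)" if "v \<in> supp a" for v using that by force
    then have "a v * m a < a v * real (M v)" if "v \<in> supp a" for v
      using that supp(5)[OF a, of v] by (intro mult_strict_left_mono) (auto simp: supp_def)
    moreover have "supp a \<noteq> {}" using supp(3)[OF a] by auto
    ultimately have "(\<Sum>v\<in>supp a. a v * m a) < m a"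
      unfolding m_def using supp(2)[OF a] by (intro sum_strict_mono) auto
    then show False using supp(3)[OF a] by (simp add: sum_distrib_right[symmetric])
  qed
  have m_pos: "0 \<le> m a" if "a \<in> R" for a using m_bound[OF that] by (meson of_nat_0_le_iff order_trans)
  have mix_R: "(\<lambda>u. (1 - t) * push (m a) a u + t * delta (m a) u) \<in> R" if a: "a \<in> R" and t: "t \<in> {0..1::real}" for a t
  proof -
    obtain k where k: "\<forall>u\<in>supp a. l u \<in> {k, Suc k} \<and> (\<forall>v\<in>supp a. (p u, p v) \<in> G k)"
      using supp_level[OF a] by blast
    obtain v where v: "v \<in> supp a" "real (M v) \<le> m a" using m_bound[OF a] by blast
    define n where "n = nat \<lfloor>m a\<rfloor>"
    \<comment> \<open>The chain \<open>k \<le> l v < M v \<le> n\<close> makes the points under the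
      support, together with \<open>x0\<close>, a clique of \<open>G n\<close>; both ends of the
      segment then lie in the prism over \<open>Q\<close>.\<close>
    have Mn: "M v \<le> n" using v(2) unfolding n_def by linarith
    have "k \<le> l v" using k v(1) by force
    then have kn: "k \<le> n" using M(1)[of v] Mn by linarith
    define Q where "Q = insert x0 (p ` supp a)"
    have Q: "finite Q" "Q \<noteq> {}" "Q \<subseteq> C" "x0 \<in> Q" "p ` supp a \<subseteq> Q"
      using supp(2,4)[OF a] V x0 by (auto simp: Q_def)
    have "(p u, x0) \<in> G n" if "u \<in> supp a" for u
      using M(2)[of u v] supp_B[OF a, of v] supp(4)[OF a] v(1) that G_le[OF Mn] by (auto simp: supp_def)
    moreover from this have "(x0, p u) \<in> G n" if "u \<in> supp a" for u
      using G_sym[of n] that by (meson symD)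
    moreover have "(p u, p w) \<in> G n" if "u \<in> supp a" "w \<in> supp a" for u w
      using k that G_le[OF kn] by blast
    ultimately have "Q \<times> Q \<subseteq> G n" using G_refl[OF x0] by (auto simp: Q_def)
    then have "(\<lambda>(x, k). c x k) ` (Q \<times> {n, Suc n}) \<in> ?S"
      using Q by (intro telescopeI_prism[OF c]) auto
    moreover have "push (m a) a \<in> simplex_realization ((\<lambda>(x, k). c x k) ` (Q \<times> {n, Suc n}))"
      using k Q kn by (intro push_in[OF a, of k]) (auto simp: n_def)
    moreover have "delta (m a) \<in> simplex_realization ((\<lambda>(x, k). c x k) ` (Q \<times> {n, Suc n}))"
      using Q by (intro delta_in[OF n_def m_pos[OF a]])
    ultimately show ?thesis using simplex_realization_convex[OF _ _ t] unfolding R_def by blast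
  qed

  have coord: "continuous_on A (\<lambda>z. snd z v)" for A :: "(real \<times> ('v \<Rightarrow> real)) set" and v
    by (rule continuous_on_product_then_coordinatewise) (intro continuous_intros)
  \<comment> \<open>The open sets \<open>a v \<noteq> 0\<close> cover \<open>R\<close>, and on each
    of them the varying support can be replaced by the finite set \<open>B v\<close>.\<close>
  have local_cont: "continuous_on ({0..1::real} \<times> R) f"
    if "\<And>v. continuous_on ({0..1::real} \<times> {a \<in> R. a v \<noteq> 0}) f" for f :: "real \<times> ('v \<Rightarrow> real) \<Rightarrow> real"
    unfolding continuous_on_def
  proof
    fix z :: "real \<times> ('v \<Rightarrow> real)" assume z: "z \<in> {0..1::real} \<times> R"
    then have "supp (snd z) \<noteq> {}" using supp(3)[of "snd z"] by auto
    then obtain v where v: "snd z v \<noteq> 0" by (auto simp: supp_def)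
    have o: "open {z :: real \<times> ('v \<Rightarrow> real). snd z v \<noteq> 0}"
      by (intro open_Collect_neq coord continuous_on_const)
    have "at z within {0..1::real} \<times> R = at z within {0..1::real} \<times> {a \<in> R. a v \<noteq> 0}"
      by (rule at_within_nhd[OF _ o]) (use v in auto)
    moreover have "(f \<longlongrightarrow> f z) (at z within {0..1::real} \<times> {a \<in> R. a v \<noteq> 0})"
      using that[of v] z v unfolding continuous_on_def by auto
    ultimately show "(f \<longlongrightarrow> f z) (at z within {0..1::real} \<times> R)" by simp
  qed
  have supp_sum: "(\<Sum>v\<in>supp a. a v * f v) = (\<Sum>v\<in>B w. a v * f v)" if "a \<in> R" "a w \<noteq> 0" for a w f
    using supp_B[OF that] B_fin by (intro sum.mono_neutral_left) (auto simp: supp_def)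
  have m_cont: "continuous_on ({0..1::real} \<times> R) (\<lambda>z. m (snd z))"
  proof (rule local_cont)
    fix w
    have "continuous_on ({0..1::real} \<times> {a \<in> R. a w \<noteq> 0}) (\<lambda>z. \<Sum>v\<in>B w. snd z v * real (M v))"
      by (intro continuous_on_sum continuous_on_mult coord continuous_on_const)
    then show "continuous_on ({0..1::real} \<times> {a \<in> R. a w \<noteq> 0}) (\<lambda>z. m (snd z))"
      by (rule continuous_on_eq) (auto simp: m_def supp_sum)
  qed
  have push_cont: "continuous_on ({0..1::real} \<times> R) (\<lambda>z. push (g z) (snd z) u)"
    if g: "continuous_on ({0..1::real} \<times> R) g" for g u
  proof (rule local_cont)
    fix w
    let ?A = "{0..1::real} \<times> {a \<in> R. a w \<noteq> 0}"
    have g': "continuous_on ?A g" using g by (rule continuous_on_subset) auto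
    have "continuous_on ?A (\<lambda>z. if p v = p u then hat (max (real (l v)) (g z) - real (l u)) else 0)" for v
      by (cases "p v = p u") (auto intro!: continuous_on_hat continuous_on_diff continuous_on_max g' continuous_on_const)
    then have "continuous_on ?A (\<lambda>z. if u \<in> V then \<Sum>v\<in>B w. snd z v *
        (if p v = p u then hat (max (real (l v)) (g z) - real (l u)) else 0) else 0)"
      by (cases "u \<in> V") (auto intro!: continuous_on_sum continuous_on_mult coord continuous_on_const)
    then show "continuous_on ?A (\<lambda>z. push (g z) (snd z) u)"
      by (rule continuous_on_eq) (auto simp: push_def supp_sum)
  qed
  have delta_cont: "continuous_on ({0..1::real} \<times> R) (\<lambda>z. delta (g z) u)"
    if g: "continuous_on ({0..1::real} \<times> R) g" for g u
    unfolding delta_def using g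
    by (cases "u \<in> V"; cases "x0 = p u") (auto intro!: continuous_on_hat continuous_on_diff continuous_on_const)
  have t_cont: "continuous_on ({0..1::real} \<times> R) fst" by (intro continuous_intros)

  have h1: "homotopic_with_canon (\<lambda>_. True) R R id (\<lambda>a. push (m a) a)"
  proof (rule homotopic_with_canonI)
    show "continuous_on ({0..1::real} \<times> R) (\<lambda>z. push (fst z * m (snd z)) (snd z))"
      by (intro continuous_on_coordinatewise_then_product push_cont continuous_on_mult t_cont m_cont)
    show "push (fst (0::real, a) * m (snd (0::real, a))) (snd (0::real, a)) = id a" if a: "a \<in> R" for a
    proof
      fix u
      \<comment> \<open>At time 0 all heights are integers, and \<open>hat\<close> vanishes at every
        integer except 0.\<close>
      have eq: "(if p v = p u then hat (real (l v) - real (l u)) else 0) = (if v = u then 1 else 0)" 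
        if "v \<in> V" "u \<in> V" for v
      proof (cases "p v = p u")
        case True
        then have "l v = l u \<longleftrightarrow> v = u" using V[OF that(1)] V[OF that(2)] by metis
        then show ?thesis using True by (auto simp: hat_def)
      qed auto
      show "push (fst (0::real, a) * m (snd (0::real, a))) (snd (0::real, a)) u = id a u"
      proof (cases "u \<in> V")
        case True
        have "(\<Sum>v\<in>supp a. a v * (if p v = p u then hat (real (l v) - real (l u)) else 0)) =
            (\<Sum>v\<in>supp a. if v = u then a v else 0)"
          using eq True supp(4)[OF a] by (intro sum.cong refl) (auto simp: subset_iff)
        also have "\<dots> = a u" using supp(2)[OF a] by (simp add: sum.delta supp_def)
        finally show ?thesis using True by (simp add: push_def max_absorb1 cong: if_cong)
      next
        case False
        then have "u \<notin> supp a" using supp(4)[OF a] by blast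
        then show ?thesis using False by (simp add: push_def supp_def)
      qed
    qed
  qed (use push_R in auto)
  have h2: "homotopic_with_canon (\<lambda>_. True) R R (\<lambda>a. push (m a) a) (\<lambda>a. delta (m a))"
  proof (rule homotopic_with_canonI)
    show "continuous_on ({0..1::real} \<times> R) (\<lambda>z u. (1 - fst z) * push (m (snd z)) (snd z) u + fst z * delta (m (snd z)) u)"
      by (intro continuous_on_coordinatewise_then_product continuous_on_add continuous_on_mult continuous_on_diff
          push_cont delta_cont t_cont m_cont continuous_on_const)
  qed (use mix_R in auto)
  have h3: "homotopic_with_canon (\<lambda>_. True) R R (\<lambda>a. delta (m a)) (\<lambda>_. delta 0)"
  proof (rule homotopic_with_canonI)
    show "continuous_on ({0..1::real} \<times> R) (\<lambda>z. delta ((1 - fst z) * m (snd z)))"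
      by (intro continuous_on_coordinatewise_then_product continuous_on_mult continuous_on_diff
          delta_cont t_cont m_cont continuous_on_const)
    show "delta ((1 - fst (t, a)) * m (snd (t, a))) \<in> R" if "t \<in> {0..1::real}" "a \<in> R" for t :: real and a
      using that m_pos by (intro delta_R) auto
  qed auto
  have "contractible R" unfolding contractible_def
    using homotopic_with_trans[OF homotopic_with_trans[OF h1 h2] h3] by blast
  then show "contractible_complex ?S" unfolding contractible_complex_def real_eq by simp
qed

section \<open>The telescope as a Borel structuring\<close>

text \<open>An arbitrary injection suffices, as the Borel structure is transported along it. It
  comes from cardinality: reals are coded by sets of naturals, a sequence of such sets by one set,
  and that set by a real.\<close>

lemma standard_borel_inj_real:
  fixes M :: "'a measure"
  assumes "standard_borel M"
  obtains j :: "'a \<times> nat \<Rightarrow> real" where "inj_on j (space M \<times> UNIV)"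
proof -
  obtain \<iota> :: "'a \<Rightarrow> nat \<Rightarrow> real" where \<iota>: "inj_on \<iota> (space M)"
  proof (cases "space M = {}")
    case True
    then show thesis using that[of undefined] by simp
  next
    case False
    obtain \<iota> :: "'a \<Rightarrow> nat \<Rightarrow> real" and r where "\<And>x. x \<in> space M \<Longrightarrow> r (\<iota> x) = x"
      by (rule standard_borel_retract[OF assms False]) blast
    then show thesis using that inj_on_inverseI by metis
  qed
  obtain h :: "real \<Rightarrow> nat set" where h: "inj h"
    using eqpoll_imp_lepoll[OF eqpoll_sym[OF nat_sets_eqpoll_reals]] unfolding lepoll_def by blast
  obtain h' :: "nat set \<Rightarrow> real" where h': "inj h'"
    using eqpoll_imp_lepoll[OF nat_sets_eqpoll_reals] unfolding lepoll_def by blast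
  define code :: "(nat \<Rightarrow> real) \<Rightarrow> nat set" where "code s = {i. snd (prod_decode i) \<in> h (s (fst (prod_decode i)))}" for s
  have code: "inj code"
  proof (rule injI, rule ext)
    fix s t n assume eq: "code s = code t"
    have "k \<in> h (s n) \<longleftrightarrow> k \<in> h (t n)" for k
      using eq unfolding code_def set_eq_iff by (auto dest: spec[of _ "prod_encode (n, k)"])
    then have "h (s n) = h (t n)" by blast
    then show "s n = t n" using h by (simp add: inj_eq)
  qed
  \<comment> \<open>The level is stored as an extra first entry of the code of the point.\<close>
  have "inj_on (\<lambda>(x, n). h' (code (case_nat (real n) (\<iota> x)))) (space M \<times> UNIV)"
  proof (rule inj_onI, clarify)
    fix x n x' n'
    assume *: "x \<in> space M" "x' \<in> space M"
      "h' (code (case_nat (real n) (\<iota> x))) = h' (code (case_nat (real n') (\<iota> x')))"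
    then have eq: "case_nat (real n) (\<iota> x) = case_nat (real n') (\<iota> x')"
      using h' code by (simp add: inj_eq)
    from fun_cong[OF eq, of 0] fun_cong[OF eq, of "Suc _"] have "n = n'" "\<iota> x = \<iota> x'" by auto
    then show "x = x' \<and> n = n'" using \<iota> * by (auto simp: inj_on_def)
  qed
  then show thesis by (rule that)
qed

section \<open>Transport of the product with the naturals\<close>

lemma measurable_continuous_map:
  assumes "sets M = sigma_sets (space M) {U. openin T U}" "topspace T = space M"
    and "sets N = sigma_sets (space N) {U. openin T' U}" "topspace T' = space N"
    and f: "continuous_map T T' f"
  shows "f \<in> M \<rightarrow>\<^sub>M N"
proof (rule measurable_sigma_sets[OF assms(3)])
  show "{U. openin T' U} \<subseteq> Pow (space N)" using assms(4) openin_subset by blast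
  show "f \<in> space M \<rightarrow> space N" using f assms(2,4) by (auto simp: continuous_map_def)
  fix U assume "U \<in> {U. openin T' U}"
  then have "openin T {x \<in> topspace T. f x \<in> U}" using f by (simp add: continuous_map_def)
  moreover have "{x \<in> topspace T. f x \<in> U} = f -` U \<inter> space M" using assms(2) by auto
  ultimately show "f -` U \<inter> space M \<in> sets M" unfolding assms(1) by (auto intro: sigma_sets.Basic)
qed

text \<open>Pulling the topology back along the inverse of \<open>j\<close> makes \<open>j\<close> a
  homeomorphism from the product with a discrete space, so all measurability claims become
  continuity of coordinate maps.\<close>

lemma standard_borel_times_nat:
  fixes M :: "'a measure" and j :: "'a \<times> nat \<Rightarrow> 'b"
  assumes M: "standard_borel M" and j: "inj_on j (space M \<times> UNIV)"
  obtains Y :: "'b measure" where "standard_borel Y" "space Y = j ` (space M \<times> UNIV)"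
    "\<And>k. (\<lambda>x. j (x, k)) \<in> M \<rightarrow>\<^sub>M Y"
    "(\<lambda>v. fst (inv_into (space M \<times> UNIV) j v)) \<in> Y \<rightarrow>\<^sub>M M"
    "(\<lambda>v. snd (inv_into (space M \<times> UNIV) j v)) \<in> Y \<rightarrow>\<^sub>M count_space UNIV"
proof -
  obtain T where T: "completely_metrizable_space T" "separable_space T" "topspace T = space M"
     "sets M = sigma_sets (space M) {U. openin T U}"
    using M unfolding standard_borel_def by blast
  define P where "P = prod_topology T (discrete_topology (UNIV :: nat set))"
  define A where "A = space M \<times> (UNIV :: nat set)"
  have P_top: "topspace P = A" by (simp add: P_def A_def T(3))
  define g where "g = inv_into A j"
  have j': "inj_on j A" using j by (simp add: A_def)
  have gj: "g (j z) = z" if "z \<in> A" for z using that j' by (simp add: g_def)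
  define T' where "T' = pullback_topology (j ` A) g P"
  have T'_top: "topspace T' = j ` A"
    using gj by (auto simp: T'_def topspace_pullback_topology P_top)
  have cg: "continuous_map T' P g"
    using continuous_map_pullback[of P P id "j ` A" g] by (simp add: T'_def)
  have cj: "continuous_map P T' j" unfolding T'_def
  proof (rule continuous_map_pullback')
    show "continuous_map P P (g \<circ> j)"
      by (rule continuous_map_eq[of P P id]) (use gj P_top in auto)
    show "topspace P \<subseteq> j -` (j ` A)" using P_top by auto
  qed
  have "homeomorphic_maps P T' j g"
    unfolding homeomorphic_maps_def using cg cj gj P_top T'_top by auto
  then have homeo: "P homeomorphic_space T'" unfolding homeomorphic_space_def by blast
  have "completely_metrizable_space P"
    unfolding P_def completely_metrizable_space_prod_topology
    using T(1) completely_metrizable_space_discrete_topology by blast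
  then have cm: "completely_metrizable_space T'" using homeomorphic_completely_metrizable_space[OF homeo] by simp
  obtain D where D: "countable D" "D \<subseteq> topspace T" "T closure_of D = topspace T"
    using T(2) unfolding separable_space_def by blast
  have "separable_space P" unfolding separable_space_def
  proof (intro exI conjI)
    show "countable (D \<times> (UNIV :: nat set))" using D(1) by simp
    show "D \<times> UNIV \<subseteq> topspace P" using D(2) by (auto simp: P_def)
    show "P closure_of (D \<times> UNIV) = topspace P" using D(3) by (simp add: P_def closure_of_Times)
  qed
  then have sep: "separable_space T'" using homeomorphic_separable_space[OF homeo] by simp
  define Y where "Y = sigma (topspace T') {U. openin T' U}"
  have sub: "{U. openin T' U} \<subseteq> Pow (topspace T')" using openin_subset by blast
  have Y_space: "space Y = topspace T'" unfolding Y_def by (rule space_measure_of[OF sub])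
  have Y_sets: "sets Y = sigma_sets (space Y) {U. openin T' U}"
    unfolding Y_space unfolding Y_def by (rule sets_measure_of[OF sub])
  have count_sets: "sets (count_space UNIV) = sigma_sets (space (count_space UNIV)) {U. openin (discrete_topology (UNIV :: nat set)) U}"
    using sigma_sets_top[of UNIV] by (auto intro: sigma_sets.Basic)
  show thesis
  proof (rule that[of Y])
    show "standard_borel Y" unfolding standard_borel_def using cm sep Y_space Y_sets by auto
    show "space Y = j ` (space M \<times> UNIV)" using Y_space T'_top by (simp add: A_def)
    show "(\<lambda>x. j (x, k)) \<in> M \<rightarrow>\<^sub>M Y" for k
    proof (rule measurable_continuous_map[OF T(4,3) Y_sets Y_space[symmetric]])
      have "continuous_map T P (\<lambda>x. (x, k))"
        unfolding P_def by (simp add: continuous_map_pairwise o_def)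
      from continuous_map_compose[OF this cj] show "continuous_map T T' (\<lambda>x. j (x, k))" by (simp add: o_def)
    qed
    show "(\<lambda>v. fst (inv_into (space M \<times> UNIV) j v)) \<in> Y \<rightarrow>\<^sub>M M"
    proof (rule measurable_continuous_map[OF Y_sets Y_space[symmetric] T(4,3)])
      show "continuous_map T' T (\<lambda>v. fst (inv_into (space M \<times> UNIV) j v))"
        using cg unfolding P_def g_def A_def by (rule continuous_map_fst_of[unfolded o_def])
    qed
    show "(\<lambda>v. snd (inv_into (space M \<times> UNIV) j v)) \<in> Y \<rightarrow>\<^sub>M count_space UNIV"
    proof (rule measurable_continuous_map[OF Y_sets Y_space[symmetric] count_sets])
      show "continuous_map T' (discrete_topology UNIV) (\<lambda>v. snd (inv_into (space M \<times> UNIV) j v))"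
        using cg unfolding P_def g_def A_def by (rule continuous_map_snd_of[unfolded o_def])
    qed simp
  qed
qed

section \<open>Simplices of the telescope: closure under faces and measurability\<close>

lemma simplicial_complex_on_telescope:
  assumes "\<And>v k. v \<in> V \<Longrightarrow> (p v, p v) \<in> G k"
  shows "simplicial_complex_on V (telescope V p l G)"
  unfolding simplicial_complex_on_def
proof (intro conjI ballI allI impI)
  fix s t assume s: "s \<in> telescope V p l G" and t: "t \<noteq> {} \<and> t \<subseteq> s"
  then obtain k where k: "\<forall>u\<in>s. l u \<in> {k, Suc k} \<and> (\<forall>v\<in>s. (p u, p v) \<in> G k)" and s': "finite s" "s \<subseteq> V"
    unfolding telescope_def by blast
  have "finite t" using s' t finite_subset by blast
  moreover have "\<forall>u\<in>t. l u \<in> {k, Suc k} \<and> (\<forall>v\<in>t. (p u, p v) \<in> G k)" using k t by blast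
  ultimately show "t \<in> telescope V p l G" unfolding telescope_def using t s' by blast
qed (use assms in \<open>auto simp: telescope_def\<close>)

text \<open>For the range of a finite sequence, being a simplex quantifies over one natural number
  \<open>k\<close> and finitely many pairs of entries: a countable union of finite intersections of
  Borel conditions.\<close>

lemma telescope_in_finite_subsets_space:
  assumes p: "p \<in> Y \<rightarrow>\<^sub>M M" and l: "l \<in> Y \<rightarrow>\<^sub>M count_space UNIV"
    and G: "\<And>k. G k \<in> sets (M \<Otimes>\<^sub>M M)"
  shows "telescope (space Y) p l G \<in> sets (finite_subsets_space Y)"
  unfolding sets_finite_subsets_space borel_finite_sets_def
proof (intro CollectI conjI allI)
  show "telescope (space Y) p l G \<subseteq> {s. finite s \<and> s \<subseteq> space Y}" by (auto simp: telescope_def)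
  fix n :: nat
  let ?P = "PiM {..<n} (\<lambda>_. Y)"
  have comp: "(\<lambda>x. x i) \<in> ?P \<rightarrow>\<^sub>M Y" if "i < n" for i
    using that by (intro measurable_component_singleton) simp
  define L where "L k i = {x \<in> space ?P. l (x i) \<in> {k, Suc k}}" for k i
  define H where "H k i i' = {x \<in> space ?P. (p (x i), p (x i')) \<in> G k}" for k i i'
  have L: "L k i \<in> sets ?P" if "i < n" for k i
  proof -
    have "(\<lambda>x. l (x i)) -` {k, Suc k} \<inter> space ?P \<in> sets ?P"
      using measurable_compose[OF comp[OF that] l] by (rule measurable_sets) simp
    moreover have "(\<lambda>x. l (x i)) -` {k, Suc k} \<inter> space ?P = L k i" by (auto simp: L_def)
    ultimately show ?thesis by simp
  qed
  have H: "H k i i' \<in> sets ?P" if "i < n" "i' < n" for k i i'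
  proof -
    have "(\<lambda>x. (p (x i), p (x i'))) \<in> ?P \<rightarrow>\<^sub>M M \<Otimes>\<^sub>M M"
      by (intro measurable_Pair measurable_compose[OF comp p] that)
    from measurable_sets[OF this G[of k]]
    have "(\<lambda>x. (p (x i), p (x i'))) -` G k \<inter> space ?P \<in> sets ?P" .
    moreover have "(\<lambda>x. (p (x i), p (x i'))) -` G k \<inter> space ?P = H k i i'" by (auto simp: H_def)
    ultimately show ?thesis by simp
  qed
  show "{x \<in> space ?P. x ` {..<n} \<in> telescope (space Y) p l G} \<in> sets ?P"
  proof (cases "n = 0")
    case True
    \<comment> \<open>The empty sequence has range \<open>{}\<close>, which is no simplex, whereas
      intersections over no indices would give the whole type.\<close>
    then have empty: "{x \<in> space ?P. x ` {..<n} \<in> telescope (space Y) p l G} = {}"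
      by (simp add: telescope_def)
    show ?thesis unfolding empty by simp
  next
    case False
    have sp: "x ` {..<n} \<subseteq> space Y" if "x \<in> space ?P" for x using that by (auto simp: space_PiM)
    have "{x \<in> space ?P. x ` {..<n} \<in> telescope (space Y) p l G} =
        (\<Union>k. \<Inter>i\<in>{..<n}. \<Inter>i'\<in>{..<n}. L k i \<inter> H k i i')"
    proof (intro set_eqI iffI)
      fix x assume "x \<in> {x \<in> space ?P. x ` {..<n} \<in> telescope (space Y) p l G}"
      then show "x \<in> (\<Union>k. \<Inter>i\<in>{..<n}. \<Inter>i'\<in>{..<n}. L k i \<inter> H k i i')"
        by (auto simp: telescope_def L_def H_def)
    next
      fix x assume "x \<in> (\<Union>k. \<Inter>i\<in>{..<n}. \<Inter>i'\<in>{..<n}. L k i \<inter> H k i i')"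
      then obtain k where "x \<in> (\<Inter>i\<in>{..<n}. \<Inter>i'\<in>{..<n}. L k i \<inter> H k i i')" by (rule UN_E)
      then have k: "x \<in> L k i \<inter> H k i i'" if "i < n" "i' < n" for i i' using that by blast
      have x: "x \<in> space ?P" using k[of 0 0] False by (simp add: L_def)
      have "\<forall>u\<in>x ` {..<n}. l u \<in> {k, Suc k} \<and> (\<forall>v\<in>x ` {..<n}. (p u, p v) \<in> G k)"
        using k by (auto simp: L_def H_def)
      then have "x ` {..<n} \<in> telescope (space Y) p l G"
        unfolding telescope_def using sp[OF x] False by auto
      then show "x \<in> {x \<in> space ?P. x ` {..<n} \<in> telescope (space Y) p l G}" using x by simp
    qed
    also have "\<dots> \<in> sets ?P"
      using L H False by (intro sets.countable_UN'' sets.finite_INT sets.Int) auto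
    finally show ?thesis .
  qed
qed

theorem corollary1p4:
  fixes X :: "'a measure" and E :: "('a \<times> 'a) set"
  assumes "countable_borel_equiv X E"
  shows "\<exists>(Y :: real measure) F.
           countable_borel_equiv Y F \<and>
           borel_embeds X E Y F \<and>
           structurable locally_finite_contractible Y F"
proof -
  have sb: "standard_borel X" and eq: "equiv (space X) E" and Em: "E \<in> sets (X \<Otimes>\<^sub>M X)"
    and cl: "\<And>C. C \<in> space X // E \<Longrightarrow> countable C"
    using assms unfolding countable_borel_equiv_def by auto
  have Esub: "E \<subseteq> space X \<times> space X" using Em sets.sets_into_space by (fastforce simp: space_pair_measure)
  have Erefl: "(x, x) \<in> E" if "x \<in> space X" for x
    using eq that by (simp add: equiv_def refl_on_def)
  have Esym: "(y, x) \<in> E" if "(x, y) \<in> E" for x y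
    using eq that by (auto simp: equiv_def sym_def)
  have Etrans: "(x, z) \<in> E" if "(x, y) \<in> E" "(y, z) \<in> E" for x y z
    using eq that unfolding equiv_def trans_def by blast
  obtain G :: "nat \<Rightarrow> ('a \<times> 'a) set" where G: "\<And>k. G k \<in> sets (X \<Otimes>\<^sub>M X)" "\<And>k. G k \<subseteq> G (Suc k)" "(\<Union>k. G k) = E"
    "\<And>k. sym (G k)" "\<And>k x. x \<in> space X \<Longrightarrow> (x, x) \<in> G k" "\<And>k x. finite (G k `` {x})"
    by (rule borel_locally_finite_exhaustion[OF assms]) blast
  obtain j :: "'a \<times> nat \<Rightarrow> real" where j: "inj_on j (space X \<times> UNIV)"
    by (rule standard_borel_inj_real[OF sb])
  define p where "p v = fst (inv_into (space X \<times> UNIV) j v)" for v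
  define l where "l v = snd (inv_into (space X \<times> UNIV) j v)" for v
  obtain Y :: "real measure" where Y: "standard_borel Y" "space Y = j ` (space X \<times> UNIV)"
    "\<And>k. (\<lambda>x. j (x, k)) \<in> X \<rightarrow>\<^sub>M Y" "p \<in> Y \<rightarrow>\<^sub>M X" "l \<in> Y \<rightarrow>\<^sub>M count_space UNIV"
    unfolding p_def l_def by (rule standard_borel_times_nat[OF sb j]) blast
  have pj: "p (j (x, k)) = x" "l (j (x, k)) = k" if "x \<in> space X" for x k
    using j that by (simp_all add: p_def l_def)
  have jp: "p v \<in> space X" "j (p v, l v) = v" if "v \<in> space Y" for v
    using that pj by (auto simp: Y(2))
  \<comment> \<open>The level is ignored, so an \<open>F\<close>-class is a copy of an entire
    \<open>E\<close>-class times the naturals, the vertex set of its telescope.\<close>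
  define F where "F = {(u, v). u \<in> space Y \<and> v \<in> space Y \<and> (p u, p v) \<in> E}"
  have F_equiv: "equiv (space Y) F"
  proof (rule equivI)
    show "F \<subseteq> space Y \<times> space Y" by (auto simp: F_def)
    show "refl_on (space Y) F" using Erefl jp by (auto simp: refl_on_def F_def)
    show "sym F" using Esym by (auto simp: sym_def F_def)
    show "trans F" using Etrans by (auto simp: trans_def F_def)
  qed
  have F_class: "\<exists>u\<in>space Y. C = F `` {u}" if "C \<in> space Y // F" for C
    using that by (auto simp: quotient_def)
  have F_cbe: "countable_borel_equiv Y F" unfolding countable_borel_equiv_def
  proof (intro conjI ballI)
    show "standard_borel Y" by (rule Y(1))
    show "equiv (space Y) F" by (rule F_equiv)
    have "(\<lambda>q. (p (fst q), p (snd q))) \<in> Y \<Otimes>\<^sub>M Y \<rightarrow>\<^sub>M X \<Otimes>\<^sub>M X"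
      by (intro measurable_Pair measurable_compose[OF measurable_fst Y(4)] measurable_compose[OF measurable_snd Y(4)])
    from measurable_sets[OF this Em]
    have "(\<lambda>q. (p (fst q), p (snd q))) -` E \<inter> space (Y \<Otimes>\<^sub>M Y) \<in> sets (Y \<Otimes>\<^sub>M Y)" .
    moreover have "(\<lambda>q. (p (fst q), p (snd q))) -` E \<inter> space (Y \<Otimes>\<^sub>M Y) = F"
      by (auto simp: F_def space_pair_measure)
    ultimately show "F \<in> sets (Y \<Otimes>\<^sub>M Y)" by simp
    fix C assume "C \<in> space Y // F"
    then obtain u where u: "u \<in> space Y" "C = F `` {u}" using F_class by blast
    have "E `` {p u} \<in> space X // E" using jp(1)[OF u(1)] by (rule quotientI)
    then have "countable (j ` (E `` {p u} \<times> UNIV))" using cl by simp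
    moreover have "C \<subseteq> j ` (E `` {p u} \<times> UNIV)"
    proof
      fix v assume "v \<in> C"
      then have v: "v \<in> space Y" "(p u, p v) \<in> E" using u by (auto simp: F_def)
      then show "v \<in> j ` (E `` {p u} \<times> UNIV)" using jp(2)[OF v(1)] by (intro image_eqI[of _ _ "(p v, l v)"]) auto
    qed
    ultimately show "countable C" using countable_subset by blast
  qed
  have emb: "borel_embeds X E Y F" unfolding borel_embeds_def borel_embedding_def
  proof (intro exI conjI ballI)
    show "(\<lambda>x. j (x, 0)) \<in> X \<rightarrow>\<^sub>M Y" by (rule Y(3))
    show "inj_on (\<lambda>x. j (x, 0)) (space X)" using pj(1) by (rule inj_on_inverseI)
    show "(x, y) \<in> E \<longleftrightarrow> (j (x, 0), j (y, 0)) \<in> F" if "x \<in> space X" "y \<in> space X" for x y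
      using that pj by (auto simp: F_def Y(2))
  qed
  let ?S = "telescope (space Y) p l G"
  have "borel_structuring locally_finite_contractible Y F ?S" unfolding borel_structuring_def
  proof (intro conjI ballI)
    show "simplicial_complex_on (space Y) ?S"
      using G(5) jp(1) by (intro simplicial_complex_on_telescope) auto
    show "?S \<in> sets (finite_subsets_space Y)"
      by (rule telescope_in_finite_subsets_space[OF Y(4,5) G(1)])
  next
    fix s assume "s \<in> ?S"
    then obtain k where s: "s \<noteq> {}" "s \<subseteq> space Y" "\<forall>u\<in>s. \<forall>v\<in>s. (p u, p v) \<in> G k"
      unfolding telescope_def by blast
    then obtain u where u: "u \<in> s" by blast
    have "s \<subseteq> F `` {u}" using s u G(3) by (auto simp: F_def)
    moreover have "F `` {u} \<in> space Y // F" using s(2) u by (intro quotientI) auto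
    ultimately show "\<exists>C\<in>space Y // F. s \<subseteq> C" by blast
  next
    fix C assume "C \<in> space Y // F"
    then obtain u where u: "u \<in> space Y" "C = F `` {u}" using F_class by blast
    have CY: "C \<subseteq> space Y" using u by (auto simp: F_def)
    \<comment> \<open>The simplices inside a class form the telescope on that class, so
      \<open>contractible_telescope\<close> applies directly.\<close>
    have tel: "{s \<in> ?S. s \<subseteq> C} = telescope C p l G" using CY by (auto simp: telescope_def)
    define D where "D = E `` {p u}"
    have D: "D \<subseteq> space X" using Esub by (auto simp: D_def)
    have c: "j (x, k) \<in> C \<and> p (j (x, k)) = x \<and> l (j (x, k)) = k" if "x \<in> D" for x k
    proof -
      have x: "x \<in> space X" "(p u, x) \<in> E" using that D by (auto simp: D_def)
      then show ?thesis using pj[OF x(1)] u by (auto simp: F_def Y(2))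
    qed
    have V: "p v \<in> D \<and> j (p v, l v) = v" if "v \<in> C" for v
      using that u jp(2) by (auto simp: F_def D_def)
    have refl: "(x, x) \<in> G k" if "x \<in> D" for x k using that D G(5) by blast
    have cover: "\<exists>k. (x, y) \<in> G k" if "x \<in> D" "y \<in> D" for x y
    proof -
      have "(x, y) \<in> E" using that Esym Etrans unfolding D_def by blast
      then show ?thesis using G(3) by blast
    qed
    \<comment> \<open>The base point lies under the representative \<open>u\<close>, chosen
      separately for each class.\<close>
    have base: "p u \<in> D" using Erefl jp(1)[OF u(1)] by (simp add: D_def)
    show "locally_finite_contractible C {s \<in> ?S. s \<subseteq> C}"
      unfolding tel locally_finite_contractible_def
    proof (intro conjI)
      show "simplicial_complex_on C (telescope C p l G)"
        using V refl by (intro simplicial_complex_on_telescope) blast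
      show "locally_finite_complex C (telescope C p l G)" "contractible_complex (telescope C p l G)"
        by (rule contractible_telescope[of D "\<lambda>x k. j (x, k)" C p l G "p u"]; use c V G refl cover base in blast)+
    qed
  qed
  then have "structurable locally_finite_contractible Y F" unfolding structurable_def by blast
  then show ?thesis using F_cbe emb by blast
qed

end
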